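(* Let $\alpha\in(0,1)$, let $J=[0,T]$ for some $T>0$ or $J=[0,\infty)$, and let $f:J\times\mathbb{R}\to\mathbb{R}$ be continuous and satisfy $|f(t,x)-f(t,y)|\le L(t)|x-y|$ for all $t\in J$, $x,y\in\mathbb{R}$, where $L:J\to[0,\infty)$ is continuous. Consider ${}^{C}D^\alpha_{0+}x(t)=f(t,x(t))$ on $J$ and its evolution mappings $\Phi_{0,t}:\mathbb{R}\to\mathbb{R}$, $t\in J$. Then: (i) $\Phi_{0,t}$ is a bijection for every $t\in J$; (ii) the maps $\Phi_{s,t}:=\Phi_{0,t}\circ\Phi_{0,s}^{-1}$, $s,t\in J$, form a two-parameter family of bijections of $\mathbb{R}$ satisfying $\Phi_{s,t}\circ\Phi_{u,s}=\Phi_{u,t}$ for all $u,s,t\in J$; (iii) the family $(\Phi_{s,t})_{s,t\in J}$ is a two-parameter flow in $\mathbb{R}$; (iv) if $f$ is linear in $x$ (i.e. $f(t,x)=a(t)x$), then each $\Phi_{s,t}$ is a linear map of $\mathbb{R}$.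
   Context: ${}^{C}D^\alpha_{0+}$ is the Caputo fractional derivative of order $\alpha$; a solution is a continuous $x:J\to\mathbb{R}$ with $x(t)=x(0)+\frac{1}{\Gamma(\alpha)}\int_0^t(t-\tau)^{\alpha-1}f(\tau,x(\tau))\,d\tau$ for all $t\in J$; under the Lipschitz condition each initial value $x_0$ yields a unique solution on $J$. The evolution mapping $\Phi_{0,t}$ sends $x_0\in\mathbb{R}$ to $x(t)$, where $x(\cdot)$ is the solution with $x(0)=x_0$. A two-parameter flow in $\mathbb{R}$ is a family of maps $\phi_{s,t}:\mathbb{R}\to\mathbb{R}$, $s,t\in J$, such that $(s,t,x)\mapsto\phi_{s,t}(x)$ is continuous on $J\times J\times\mathbb{R}$, each $\phi_{s,t}$ is a homeomorphism of $\mathbb{R}$, and $\phi_{s,t}\circ\phi_{u,s}=\phi_{u,t}$ for all $u,s,t\in J$. *)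

theory Defs
  imports "HOL-Analysis.Analysis"
begin

text \<open>A solution of the Caputo problem  D^alpha x(t) = f(t, x(t))  on the interval J
  (in its integral form): a continuous x on J such that for every t in J the
  weakly singular integrand is integrable on [0,t] and
  x(t) = x(0) + 1/Gamma(alpha) * int_0^t (t - tau)^(alpha-1) f(tau, x(tau)) dtau.\<close>
definition caputo_solution ::
  "real \<Rightarrow> (real \<Rightarrow> real \<Rightarrow> real) \<Rightarrow> real set \<Rightarrow> (real \<Rightarrow> real) \<Rightarrow> bool" where
  "caputo_solution \<alpha> f J x \<longleftrightarrow>
     continuous_on J x \<and>
     (\<forall>t\<in>J. (\<lambda>\<tau>. (t - \<tau>) powr (\<alpha> - 1) * f \<tau> (x \<tau>)) integrable_on {0..t} \<and>
        x t = x 0 + (1 / Gamma \<alpha>) *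
              integral {0..t} (\<lambda>\<tau>. (t - \<tau>) powr (\<alpha> - 1) * f \<tau> (x \<tau>)))"

definition evolution0 ::
  "real \<Rightarrow> (real \<Rightarrow> real \<Rightarrow> real) \<Rightarrow> real set \<Rightarrow> real \<Rightarrow> real \<Rightarrow> real" where
  "evolution0 \<alpha> f J t x0 =
     (THE y. \<exists>x. caputo_solution \<alpha> f J x \<and> x 0 = x0 \<and> x t = y)"

definition evolution ::
  "real \<Rightarrow> (real \<Rightarrow> real \<Rightarrow> real) \<Rightarrow> real set \<Rightarrow> real \<Rightarrow> real \<Rightarrow> real \<Rightarrow> real" where
  "evolution \<alpha> f J s t = evolution0 \<alpha> f J t \<circ> inv (evolution0 \<alpha> f J s)"

definition two_param_flow :: "real set \<Rightarrow> (real \<Rightarrow> real \<Rightarrow> real \<Rightarrow> real) \<Rightarrow> bool" where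
  "two_param_flow J \<phi> \<longleftrightarrow>
     continuous_on (J \<times> J \<times> UNIV) (\<lambda>(s, t, x). \<phi> s t x) \<and>
     (\<forall>s\<in>J. \<forall>t\<in>J. \<exists>g. homeomorphism UNIV UNIV (\<phi> s t) g) \<and>
     (\<forall>u\<in>J. \<forall>s\<in>J. \<forall>t\<in>J. \<phi> s t \<circ> \<phi> u s = \<phi> u t)"

end

theory Submission
  imports Defs
begin

text \<open>
  The difference \<open>v\<close> of two solutions satisfies \<open>v = v 0 + I\<^sup>\<alpha> g\<close> with \<open>g\<close> continuous. Inverting the Abel
  operator \<open>I\<^sup>\<alpha>\<close> by \<open>I\<^sup>1\<^sup>-\<^sup>\<alpha>\<close> and comparing increments of \<open>I\<^sup>1\<^sup>-\<^sup>\<alpha> v\<close> on the left of a point \<open>T\<close> shows: if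
  \<open>v 0 > 0\<close>, \<open>v \<ge> 0\<close> on \<open>[0, T]\<close> and \<open>v T = 0\<close>, then \<open>g T < 0\<close>. This is a comparison principle.
  Applied to \<open>v\<close> and the positive solutions of the linear equations with coefficients \<open>M\<close> and \<open>- M\<close>,
  where \<open>M\<close> is a Lipschitz constant of \<open>f\<close>, it bounds the distance of two solutions from both
  sides by multiples of their initial distance, uniformly on compact time intervals. Hence each \<open>\<Phi>\<^sub>0\<^sub>,\<^sub>t\<close> is
  an increasing bi-Lipschitz bijection, and the inverses depend continuously on \<open>t\<close> as well.
\<close>

section \<open>The Abel integral operator\<close>

text \<open>Up to the factor \<open>1 / Gamma a\<close> this is the Riemann-Liouville integral of
  order \<open>a\<close>; keeping the factor outside frees the kernel estimates from
  \<open>Gamma\<close>. At \<tau> = t the kernel has value 0, since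
  \<open>0 powr x = 0\<close>.\<close>

definition abel :: "real \<Rightarrow> (real \<Rightarrow> real) \<Rightarrow> real \<Rightarrow> real" where
  "abel a g t = integral {0..t} (\<lambda>\<tau>. (t - \<tau>) powr (a - 1) * g \<tau>)"

lemma has_integral_abel_kernel:
  fixes a :: real
  assumes "0 < a" "p \<le> q" "q \<le> t"
  shows "((\<lambda>\<tau>. (t - \<tau>) powr (a - 1)) has_integral ((t - p) powr a - (t - q) powr a) / a) {p..q}"
proof -
  have "((\<lambda>\<tau>. (t - \<tau>) powr (a - 1)) has_integral
      (\<lambda>\<tau>. - ((t - \<tau>) powr a) / a) q - (\<lambda>\<tau>. - ((t - \<tau>) powr a) / a) p) {p..q}"
  \<comment> \<open>The interior version is needed for \<open>q = t\<close>: there the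
    antiderivative is continuous but not differentiable.\<close>
  proof (rule fundamental_theorem_of_calculus_interior[OF assms(2)])
    show "continuous_on {p..q} (\<lambda>\<tau>. - ((t - \<tau>) powr a) / a)"
      using assms by (intro continuous_intros continuous_on_powr') auto
    show "((\<lambda>\<tau>. - ((t - \<tau>) powr a) / a) has_vector_derivative (t - x) powr (a - 1)) (at x)"
      if "x \<in> {p<..<q}" for x
      unfolding has_real_derivative_iff_has_vector_derivative[symmetric]
      by (rule derivative_eq_intros refl | use that assms in \<open>simp add: powr_diff field_simps\<close>)+
  qed
  thus ?thesis by (simp add: diff_divide_distrib)
qed

text \<open>The kernel is nonnegative and integrable, hence absolutely integrable, and a bounded
  measurable factor preserves this. The absolute form later permits the passage to Lebesgue
  integrals for Fubini.\<close>

lemma absolutely_integrable_abel: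
  fixes a :: real
  assumes "0 < a" "p \<le> q" "q \<le> t" "continuous_on {p..q} g"
  shows "(\<lambda>\<tau>. (t - \<tau>) powr (a - 1) * g \<tau>) absolutely_integrable_on {p..q}"
proof -
  have "(\<lambda>\<tau>. (t - \<tau>) powr (a - 1)) absolutely_integrable_on {p..q}"
    using has_integral_abel_kernel[OF assms(1-3)]
    by (intro nonnegative_absolutely_integrable_1) (auto simp: has_integral_iff)
  moreover have "g \<in> borel_measurable (lebesgue_on {p..q})"
    using assms by (intro continuous_imp_measurable_on_sets_lebesgue) auto
  moreover have "bounded (g ` {p..q})"
    using assms by (intro compact_imp_bounded compact_continuous_image) auto
  ultimately have "(\<lambda>\<tau>. g \<tau> * (t - \<tau>) powr (a - 1)) absolutely_integrable_on {p..q}"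
    by (intro absolutely_integrable_bounded_measurable_product_real) auto
  thus ?thesis by (simp add: mult.commute)
qed

lemma integrable_abel:
  fixes a :: real
  assumes "0 < a" "q \<le> t" "continuous_on {p..q} g"
  shows "(\<lambda>\<tau>. (t - \<tau>) powr (a - 1) * g \<tau>) integrable_on {p..q}"
  using absolutely_integrable_abel[of a p q t g] assms
  by (cases "p \<le> q") (auto simp: absolutely_integrable_on_def)

lemma abs_integral_abel_le:
  fixes a :: real
  assumes "0 < a" "p \<le> q" "q \<le> t" "continuous_on {p..q} g" "\<And>\<tau>. \<tau> \<in> {p..q} \<Longrightarrow> \<bar>g \<tau>\<bar> \<le> C"
  shows "\<bar>integral {p..q} (\<lambda>\<tau>. (t - \<tau>) powr (a - 1) * g \<tau>)\<bar> \<le> C * (((t - p) powr a - (t - q) powr a) / a)"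
proof -
  have h: "((\<lambda>\<tau>. C * (t - \<tau>) powr (a - 1)) has_integral C * (((t - p) powr a - (t - q) powr a) / a)) {p..q}"
    by (intro has_integral_mult_right has_integral_abel_kernel assms)
  have "norm (integral {p..q} (\<lambda>\<tau>. (t - \<tau>) powr (a - 1) * g \<tau>)) \<le> integral {p..q} (\<lambda>\<tau>. C * (t - \<tau>) powr (a - 1))"
    using h assms
    by (intro integral_norm_bound_integral integrable_abel)
       (auto simp: has_integral_iff abs_mult mult.commute[of C] intro!: mult_left_mono)
  thus ?thesis using h by (simp add: has_integral_iff)
qed

text \<open>For \<open>a < 1\<close> the kernel decreases when its upper argument grows from
  \<open>s\<close> to \<open>t\<close>, so the difference of kernels has a sign and its integral is
  explicit. The contribution at \<open>p\<close> has a favourable sign and is dropped, which makes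
  the bound independent of \<open>p\<close>.\<close>

lemma abs_integral_abel_diff_le:
  fixes a :: real
  assumes "0 < a" "a < 1" "p \<le> q" "q \<le> s" "s \<le> t"
    and "continuous_on {p..q} g" "\<And>\<tau>. \<tau> \<in> {p..q} \<Longrightarrow> \<bar>g \<tau>\<bar> \<le> C"
  shows "\<bar>integral {p..q} (\<lambda>\<tau>. (t - \<tau>) powr (a - 1) * g \<tau>)
      - integral {p..q} (\<lambda>\<tau>. (s - \<tau>) powr (a - 1) * g \<tau>)\<bar> \<le> C * (((t - q) powr a - (s - q) powr a) / a)"
proof -
  define d where "d = (\<lambda>\<tau>. (s - \<tau>) powr (a - 1) - (t - \<tau>) powr (a - 1))"
  have C0: "0 \<le> C" using assms(7)[of p] assms(3) by auto
  have hd: "((\<lambda>\<tau>. C * d \<tau>) has_integral C * (((s - p) powr a - (s - q) powr a) / a - ((t - p) powr a - (t - q) powr a) / a)) {p..q}"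
    unfolding d_def using assms
    by (intro has_integral_mult_right has_integral_diff has_integral_abel_kernel) auto
  have i: "(\<lambda>\<tau>. (s - \<tau>) powr (a - 1) * g \<tau>) integrable_on {p..q}"
          "(\<lambda>\<tau>. (t - \<tau>) powr (a - 1) * g \<tau>) integrable_on {p..q}"
    using assms by (auto intro!: integrable_abel)
  have dn: "0 \<le> d \<tau>" if "\<tau> \<in> {p..q} - {q}" for \<tau>
    using that assms unfolding d_def by (simp add: powr_mono2')
  have e: "integral {p..q} (\<lambda>\<tau>. d \<tau> * g \<tau>) = integral {p..q} (\<lambda>\<tau>. (s - \<tau>) powr (a - 1) * g \<tau>)
      - integral {p..q} (\<lambda>\<tau>. (t - \<tau>) powr (a - 1) * g \<tau>)"
    unfolding d_def left_diff_distrib using i by (rule integral_diff)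
  \<comment> \<open>If \<open>q = s\<close>, the convention \<open>0 powr x = 0\<close> makes
    \<open>d q\<close> nonpositive. Resetting this single point restores the sign without changing
    the integrals.\<close>
  define d' where "d' = (\<lambda>\<tau>. if \<tau> = q then 0 else d \<tau>)"
  have "integral {p..q} (\<lambda>\<tau>. d \<tau> * g \<tau>) = integral {p..q} (\<lambda>\<tau>. d' \<tau> * g \<tau>)"
    by (rule integral_spike[of "{q}"]) (auto simp: d'_def)
  moreover have "norm (integral {p..q} (\<lambda>\<tau>. d' \<tau> * g \<tau>)) \<le> integral {p..q} (\<lambda>\<tau>. C * d' \<tau>)"
  proof (rule integral_norm_bound_integral)
    have "(\<lambda>\<tau>. d \<tau> * g \<tau>) integrable_on {p..q}"
      unfolding d_def left_diff_distrib using i by (rule integrable_diff)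
    thus "(\<lambda>\<tau>. d' \<tau> * g \<tau>) integrable_on {p..q}"
      by (rule integrable_spike[of _ _ "{q}"]) (auto simp: d'_def)
    show "(\<lambda>\<tau>. C * d' \<tau>) integrable_on {p..q}"
    proof (rule integrable_spike[of _ _ "{q}"])
      show "(\<lambda>\<tau>. C * d \<tau>) integrable_on {p..q}" using hd by (rule has_integral_integrable)
    qed (auto simp: d'_def)
    show "norm (d' \<tau> * g \<tau>) \<le> C * d' \<tau>" if "\<tau> \<in> {p..q}" for \<tau>
      using dn[of \<tau>] that assms(7)[of \<tau>]
      by (cases "\<tau> = q") (auto simp: d'_def abs_mult mult.commute[of C] intro!: mult_left_mono)
  qed
  moreover have "integral {p..q} (\<lambda>\<tau>. C * d' \<tau>) = integral {p..q} (\<lambda>\<tau>. C * d \<tau>)"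
    by (rule integral_spike[of "{q}"]) (auto simp: d'_def)
  ultimately have "\<bar>integral {p..q} (\<lambda>\<tau>. d \<tau> * g \<tau>)\<bar> \<le> C * (((s - p) powr a - (s - q) powr a) / a - ((t - p) powr a - (t - q) powr a) / a)"
    using integral_unique[OF hd] unfolding real_norm_def by linarith
  also have "\<dots> \<le> C * (((t - q) powr a - (s - q) powr a) / a)"
  proof (rule mult_left_mono[OF _ C0])
    have "(s - p) powr a \<le> (t - p) powr a" using assms by (intro powr_mono2) auto
    thus "((s - p) powr a - (s - q) powr a) / a - ((t - p) powr a - (t - q) powr a) / a
        \<le> ((t - q) powr a - (s - q) powr a) / a"
      using assms by (simp add: field_simps)
  qed
  finally show ?thesis using e by simp
qed

text \<open>Hoelder continuity of order \<open>a\<close>: the new piece \<open>{s..t}\<close> and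
  the change of kernel on \<open>{p..s}\<close> each contribute at most
  \<open>C * (t - s) powr a / a\<close>. The lower limit \<open>p\<close> is arbitrary so that the
  bound also applies close to a contact point.\<close>

lemma abs_integral_abel_holder:
  fixes a :: real
  assumes "0 < a" "a < 1" "p \<le> s" "s \<le> t"
    and "continuous_on {p..t} g" "\<And>\<tau>. \<tau> \<in> {p..t} \<Longrightarrow> \<bar>g \<tau>\<bar> \<le> C"
  shows "\<bar>integral {p..t} (\<lambda>\<tau>. (t - \<tau>) powr (a - 1) * g \<tau>)
      - integral {p..s} (\<lambda>\<tau>. (s - \<tau>) powr (a - 1) * g \<tau>)\<bar> \<le> 2 * C * (t - s) powr a / a"
proof -
  have c: "continuous_on {p..s} g" "continuous_on {s..t} g"
    using assms by (auto intro: continuous_on_subset)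
  have "integral {p..s} (\<lambda>\<tau>. (t - \<tau>) powr (a - 1) * g \<tau>) + integral {s..t} (\<lambda>\<tau>. (t - \<tau>) powr (a - 1) * g \<tau>)
      = integral {p..t} (\<lambda>\<tau>. (t - \<tau>) powr (a - 1) * g \<tau>)"
    using assms by (intro Henstock_Kurzweil_Integration.integral_combine integrable_abel) auto
  moreover have "\<bar>integral {s..t} (\<lambda>\<tau>. (t - \<tau>) powr (a - 1) * g \<tau>)\<bar> \<le> C * (((t - s) powr a - (t - t) powr a) / a)"
    using assms c by (intro abs_integral_abel_le) auto
  moreover have "\<bar>integral {p..s} (\<lambda>\<tau>. (t - \<tau>) powr (a - 1) * g \<tau>)
      - integral {p..s} (\<lambda>\<tau>. (s - \<tau>) powr (a - 1) * g \<tau>)\<bar> \<le> C * (((t - s) powr a - (s - s) powr a) / a)"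
    using assms c by (intro abs_integral_abel_diff_le) auto
  ultimately show ?thesis by simp
qed

lemma continuous_on_bounded_Icc:
  fixes g :: "real \<Rightarrow> real"
  assumes "continuous_on {p..q} g"
  obtains C where "0 < C" "\<And>\<tau>. \<tau> \<in> {p..q} \<Longrightarrow> \<bar>g \<tau>\<bar> \<le> C"
proof -
  have "bounded (g ` {p..q})"
    using assms by (intro compact_imp_bounded compact_continuous_image) auto
  thus ?thesis using that unfolding bounded_pos by auto
qed

lemma continuous_on_abel:
  fixes a :: real
  assumes "0 < a" "a < 1" "continuous_on {0..T} g"
  shows "continuous_on {0..T} (abel a g)"
proof -
  obtain C where C: "0 < C" "\<And>\<tau>. \<tau> \<in> {0..T} \<Longrightarrow> \<bar>g \<tau>\<bar> \<le> C"
    using continuous_on_bounded_Icc[OF assms(3)] by blast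
  have le: "\<bar>abel a g t - abel a g s\<bar> \<le> 2 * C * \<bar>t - s\<bar> powr a / a" if "s \<in> {0..T}" "t \<in> {0..T}" for s t
  proof -
    have *: "\<bar>abel a g t - abel a g s\<bar> \<le> 2 * C * (t - s) powr a / a"
      if "s \<in> {0..T}" "t \<in> {0..T}" "s \<le> t" for s t
      unfolding abel_def using that assms C(2)
      by (intro abs_integral_abel_holder) (auto intro: continuous_on_subset)
    show ?thesis using *[of s t] *[of t s] that by (cases "s \<le> t") (auto simp: abs_minus_commute)
  qed
  show ?thesis unfolding continuous_on_def
  proof
    fix s assume s: "s \<in> {0..T}"
    have "((\<lambda>t. 2 * C * \<bar>t - s\<bar> powr a / a) \<longlongrightarrow> 2 * C * \<bar>s - s\<bar> powr a / a) (at s within {0..T})"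
      using assms(1) by (intro tendsto_intros tendsto_powr') auto
    hence "((\<lambda>t. 2 * C * \<bar>t - s\<bar> powr a / a) \<longlongrightarrow> 0) (at s within {0..T})" by simp
    moreover have "\<forall>\<^sub>F t in at s within {0..T}. norm (abel a g t - abel a g s) \<le> 2 * C * \<bar>t - s\<bar> powr a / a"
      unfolding eventually_at_filter using le s by (auto intro!: always_eventually)
    ultimately have "((\<lambda>t. abel a g t - abel a g s) \<longlongrightarrow> 0) (at s within {0..T})"
      by (rule Lim_null_comparison[rotated])
    thus "(abel a g \<longlongrightarrow> abel a g s) (at s within {0..T})" by (simp add: LIM_zero_iff)
  qed
qed

section \<open>Inversion of the Abel operator\<close>

lemma has_integral_beta_kernel:
  fixes a :: real
  assumes "0 < a" "a < 1" "\<tau> < t"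
  shows "((\<lambda>s. (t - s) powr (- a) * (s - \<tau>) powr (a - 1)) has_integral Gamma a * Gamma (1 - a)) {\<tau>..t}"
proof -
  \<comment> \<open>The substitution x = m * s + c maps \<open>{\<tau>..t}\<close> onto the unit
    interval. The exponents of \<open>m\<close> add up to 0, so the value depends on neither \<tau>
    nor \<open>t\<close>.\<close>
  define m where "m = 1 / (t - \<tau>)"
  define c where "c = - \<tau> * m"
  have m: "m > 0" "m * (t - \<tau>) = 1" using assms by (auto simp: m_def)
  have B: "((\<lambda>x. x powr (a - 1) * (1 - x) powr (1 - a - 1)) has_integral Beta a (1 - a)) (cbox 0 1)"
    using has_integral_Beta_real[of a "1 - a"] assms by simp
  have bd: "(0 - c) /\<^sub>R m = \<tau>" "(1 - c) /\<^sub>R m = t"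
    using m by (auto simp: c_def field_simps)
  have "((\<lambda>x. (m * x + c) powr (a - 1) * (1 - (m * x + c)) powr (- a)) has_integral Beta a (1 - a) * (t - \<tau>)) {\<tau>..t}"
    using has_integral_affinity'[OF B m(1), of c] assms unfolding bd by (simp add: m_def mult.commute)
  hence "((\<lambda>x. m * ((m * x + c) powr (a - 1) * (1 - (m * x + c)) powr (- a))) has_integral m * (Beta a (1 - a) * (t - \<tau>))) {\<tau>..t}"
    by (rule has_integral_mult_right)
  moreover have "m * (Beta a (1 - a) * (t - \<tau>)) = Gamma a * Gamma (1 - a)"
    using assms by (simp add: m_def Beta_def)
  moreover have "m * ((m * x + c) powr (a - 1) * (1 - (m * x + c)) powr (- a)) = (t - x) powr (- a) * (x - \<tau>) powr (a - 1)"
    if "x \<in> {\<tau>..t}" for x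
  proof -
    have e: "m * x + c = (x - \<tau>) * m" "1 - (m * x + c) = (t - x) * m"
      using m(2) by (auto simp: c_def algebra_simps)
    have "m * (((x - \<tau>) * m) powr (a - 1) * ((t - x) * m) powr (- a))
        = (t - x) powr (- a) * (x - \<tau>) powr (a - 1) * (m powr 1 * (m powr (a - 1) * m powr (- a)))"
      using m that by (simp add: powr_mult)
    also have "m powr 1 * (m powr (a - 1) * m powr (- a)) = 1"
      using m unfolding powr_add[symmetric] by simp
    finally show ?thesis unfolding e(2) unfolding e(1) by simp
  qed
  ultimately show ?thesis by (subst has_integral_cong) auto
qed

text \<open>Absolute integrability refers to the completed measure, while Fubini is applied to
  \<open>lborel\<close>; Borel measurability bridges the two.\<close>

lemma absolutely_integrable_on_imp_set_integrable_lborel: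
  fixes f :: "real \<Rightarrow> real"
  assumes "f absolutely_integrable_on S" "S \<in> sets borel" "f \<in> borel_measurable borel"
  shows "set_integrable lborel S f"
  using assms unfolding set_integrable_def
  by (subst (asm) integrable_completion) auto

text \<open>The kernels \<open>u\<^sup>-\<^sup>a\<close> and \<open>u\<^sup>a\<^sup>-\<^sup>1\<close> convolve to a constant, by the Beta integral.\<close>

lemma abel_inverse:
  fixes a :: real
  assumes a: "0 < a" "a < 1" and t: "0 \<le> t" and g: "continuous_on {0..t} g"
  shows "abel (1 - a) (abel a g) t = Gamma a * Gamma (1 - a) * integral {0..t} g"
proof -
  \<comment> \<open>Constant continuation of \<open>g\<close> beyond \<open>{0..t}\<close>,
    continuous and hence Borel measurable on the whole line.\<close>
  define gg where "gg = (\<lambda>\<tau>. g (max 0 (min t \<tau>)))"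
  have "continuous_on UNIV gg"
    unfolding gg_def using t by (intro continuous_on_compose2[OF g] continuous_intros) auto
  hence gm[measurable]: "gg \<in> borel_measurable borel" by (rule borel_measurable_continuous_onI)
  have gg: "gg \<tau> = g \<tau>" if "\<tau> \<in> {0..t}" for \<tau> using that by (simp add: gg_def min_absorb2)
  have cg: "continuous_on {0..s} gg" for s using \<open>continuous_on UNIV gg\<close> by (rule continuous_on_subset) auto
  \<comment> \<open>The double integrand on the triangle 0 \<le> \<tau> \<le> s \<le> t. The null
    line \<tau> = t is cut off because the Beta integral needs \<tau> < t.\<close>
  define F where "F = (\<lambda>\<tau> s. if 0 \<le> \<tau> \<and> \<tau> < t \<and> \<tau> \<le> s \<and> s \<le> t
      then (t - s) powr (- a) * (s - \<tau>) powr (a - 1) * gg \<tau> else 0)"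
  have Fm[measurable]: "case_prod F \<in> borel_measurable (lborel \<Otimes>\<^sub>M lborel)"
    unfolding F_def by measurable
  define B where "B = Gamma a * Gamma (1 - a)"
  define k where "k = (\<lambda>\<tau> s. (t - s) powr (- a) * (s - \<tau>) powr (a - 1))"
  have k: "set_integrable lborel {\<tau>..t} (k \<tau>)" "(LINT s:{\<tau>..t}|lborel. k \<tau> s) = B" if "\<tau> < t" for \<tau>
  proof -
    have h: "(k \<tau> has_integral B) {\<tau>..t}"
      unfolding k_def B_def using has_integral_beta_kernel[OF a that] .
    have "k \<tau> absolutely_integrable_on {\<tau>..t}"
      using h by (intro nonnegative_absolutely_integrable_1) (auto simp: has_integral_iff k_def)
    thus i: "set_integrable lborel {\<tau>..t} (k \<tau>)"
      by (rule absolutely_integrable_on_imp_set_integrable_lborel) (auto simp: k_def)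
    show "(LINT s:{\<tau>..t}|lborel. k \<tau> s) = B"
      using set_borel_integral_eq_integral(2)[OF i] h by (simp add: has_integral_iff)
  qed
  have F_eq: "F \<tau> = (\<lambda>s. (indicator {0..<t} \<tau> * gg \<tau>) * (indicator {\<tau>..t} s *\<^sub>R k \<tau> s))" for \<tau>
    by (auto simp: F_def k_def indicator_def fun_eq_iff)
  have nF_eq: "(\<lambda>s. norm (F \<tau> s)) = (\<lambda>s. \<bar>indicator {0..<t} \<tau> * gg \<tau>\<bar> * (indicator {\<tau>..t} s *\<^sub>R k \<tau> s))" for \<tau>
    by (auto simp: F_def k_def indicator_def fun_eq_iff abs_mult)
  have inner: "integrable lborel (F \<tau>)" "(\<integral>s. F \<tau> s \<partial>lborel) = indicator {0..<t} \<tau> * gg \<tau> * B"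
     "(\<integral>s. norm (F \<tau> s) \<partial>lborel) = \<bar>indicator {0..<t} \<tau> * gg \<tau>\<bar> * B" for \<tau>
  proof -
    show "integrable lborel (F \<tau>)"
    proof (cases "\<tau> < t")
      case True
      show ?thesis
        unfolding F_eq using k(1)[OF True, unfolded set_integrable_def] by (rule integrable_mult_right)
    qed (auto simp: F_eq)
    show "(\<integral>s. F \<tau> s \<partial>lborel) = indicator {0..<t} \<tau> * gg \<tau> * B"
    proof (cases "\<tau> < t")
      case True
      show ?thesis
        unfolding F_eq integral_mult_right_zero k(2)[OF True, unfolded set_lebesgue_integral_def] ..
    qed (auto simp: F_eq)
    show "(\<integral>s. norm (F \<tau> s) \<partial>lborel) = \<bar>indicator {0..<t} \<tau> * gg \<tau>\<bar> * B"
    proof (cases "\<tau> < t")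
      case True
      show ?thesis
        unfolding nF_eq integral_mult_right_zero k(2)[OF True, unfolded set_lebesgue_integral_def] ..
    qed (auto simp: F_eq)
  qed
  have gi: "set_integrable lborel {0..<t} gg"
    using borel_integrable_atLeastAtMost'[OF cg[of t]] by (rule set_integrable_subset) auto
  \<comment> \<open>Integrating the absolute value over \<open>s\<close> first leaves \<bar>g\<bar>
    times the constant \<open>B\<close>, which is integrable.\<close>
  have FI: "integrable (lborel \<Otimes>\<^sub>M lborel) (case_prod F)"
  proof (rule lborel_pair.Fubini_integrable)
    show "integrable lborel (\<lambda>\<tau>. \<integral>s. norm (case_prod F (\<tau>, s)) \<partial>lborel)"
      using gi unfolding set_integrable_def prod.case inner
      by (intro integrable_mult_left integrable_abs) simp
  qed (auto simp: inner)
  \<comment> \<open>The other order of integration recovers \<open>abel a g s\<close>. Cutting off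
    \<tau> = t could matter only for s = t, where the outer factor is 0 by the convention for
    \<open>powr\<close>.\<close>
  have H: "(\<integral>\<tau>. F \<tau> s \<partial>lborel) = (if s \<in> {0..t} then (t - s) powr (1 - a - 1) * abel a g s else 0)" for s
  proof (cases "s \<in> {0..t}")
    case True
    have "(\<lambda>\<tau>. (s - \<tau>) powr (a - 1) * gg \<tau>) absolutely_integrable_on {0..s}"
      using True a cg by (intro absolutely_integrable_abel) auto
    hence i: "set_integrable lborel {0..s} (\<lambda>\<tau>. (s - \<tau>) powr (a - 1) * gg \<tau>)"
      by (rule absolutely_integrable_on_imp_set_integrable_lborel) auto
    have "(\<lambda>\<tau>. F \<tau> s) = (\<lambda>\<tau>. (t - s) powr (- a) * (indicator {0..s} \<tau> *\<^sub>R ((s - \<tau>) powr (a - 1) * gg \<tau>)))"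
      using True by (auto simp: F_def indicator_def fun_eq_iff)
    hence "(\<integral>\<tau>. F \<tau> s \<partial>lborel) = (t - s) powr (- a) * (LINT \<tau>:{0..s}|lborel. (s - \<tau>) powr (a - 1) * gg \<tau>)"
      by (simp only: set_lebesgue_integral_def integral_mult_right_zero)
    also have "(LINT \<tau>:{0..s}|lborel. (s - \<tau>) powr (a - 1) * gg \<tau>) = integral {0..s} (\<lambda>\<tau>. (s - \<tau>) powr (a - 1) * gg \<tau>)"
      using i by (rule set_borel_integral_eq_integral)
    also have "\<dots> = abel a g s"
      unfolding abel_def using True gg by (intro integral_cong) auto
    finally show ?thesis using True by simp
  next
    case False
    hence "(\<lambda>\<tau>. F \<tau> s) = (\<lambda>\<tau>. 0)" by (auto simp: F_def)
    thus ?thesis unfolding if_not_P[OF False] by simp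
  qed
  have "abel (1 - a) (abel a g) t = integral UNIV (\<lambda>s. if s \<in> {0..t} then (t - s) powr (1 - a - 1) * abel a g s else 0)"
    unfolding integral_restrict_UNIV by (simp add: abel_def)
  also have "\<dots> = integral UNIV (\<lambda>s. \<integral>\<tau>. F \<tau> s \<partial>lborel)" by (simp only: H)
  also have "\<dots> = (\<integral>s. (\<integral>\<tau>. F \<tau> s \<partial>lborel) \<partial>lborel)"
    using lborel_pair.integrable_snd[OF FI] by (rule integral_lborel)
  also have "\<dots> = (\<integral>\<tau>. (\<integral>s. F \<tau> s \<partial>lborel) \<partial>lborel)"
    using FI by (rule lborel_pair.Fubini_integral)
  also have "\<dots> = B * (LINT \<tau>:{0..<t}|lborel. gg \<tau>)"
    by (simp add: inner set_lebesgue_integral_def)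
  also have "(LINT \<tau>:{0..<t}|lborel. gg \<tau>) = integral {0..<t} gg"
    using gi by (rule set_borel_integral_eq_integral)
  also have "\<dots> = integral {0..t} gg"
    using t by (intro integral_subset_negligible) (auto intro: negligible_subset[of "{t}"])
  also have "\<dots> = integral {0..t} g" using gg by (intro integral_cong) auto
  finally show ?thesis by (simp add: B_def)
qed

section \<open>Contact points\<close>

text \<open>Concavity of the power function: by the mean value theorem the secant slope lies between
  the tangent slopes at the two ends.\<close>

lemma powr_diff_tangent_bounds:
  fixes a p q :: real
  assumes "0 < a" "a < 1" "0 < p" "p \<le> q"
  shows "q powr a - p powr a \<le> a * p powr (a - 1) * (q - p)"
    and "a * q powr (a - 1) * (q - p) \<le> q powr a - p powr a"
proof -
  have "q powr a - p powr a \<le> a * p powr (a - 1) * (q - p) \<and> a * q powr (a - 1) * (q - p) \<le> q powr a - p powr a"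
  proof (cases "p = q")
    case False
    hence "p < q" using assms by simp
    moreover have "((\<lambda>x. x powr a) has_real_derivative a * x powr (a - 1)) (at x)" if "p \<le> x" "x \<le> q" for x
      using that assms by (intro has_real_derivative_powr) auto
    ultimately obtain z where z: "p < z" "z < q" "q powr a - p powr a = (q - p) * (a * z powr (a - 1))"
      using MVT2[of p q "\<lambda>x. x powr a" "\<lambda>x. a * x powr (a - 1)"] by blast
    have "z powr (a - 1) \<le> p powr (a - 1)" "q powr (a - 1) \<le> z powr (a - 1)"
      using z assms by (auto intro!: powr_mono2')
    thus ?thesis using z assms by (auto simp: mult.commute mult.left_commute intro!: mult_left_mono)
  qed auto
  thus "q powr a - p powr a \<le> a * p powr (a - 1) * (q - p)"
    and "a * q powr (a - 1) * (q - p) \<le> q powr a - p powr a" by auto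
qed

text \<open>Serves twice: to apply a second Abel operator to \<open>v0 + abel a g / Gamma a\<close>,
  and to shift a density by a constant.\<close>

lemma abel_affine:
  fixes b :: real
  assumes "0 < b" "0 \<le> t" "continuous_on {0..t} w"
  shows "abel b (\<lambda>\<tau>. c + d * w \<tau>) t = c * t powr b / b + d * abel b w t"
proof -
  have "((\<lambda>\<tau>. c * (t - \<tau>) powr (b - 1) + d * ((t - \<tau>) powr (b - 1) * w \<tau>)) has_integral
      c * (((t - 0) powr b - (t - t) powr b) / b) + d * abel b w t) {0..t}"
    unfolding abel_def using assms
    by (intro has_integral_add has_integral_mult_right has_integral_abel_kernel integrable_integral integrable_abel) auto
  moreover have "(\<lambda>\<tau>. c * (t - \<tau>) powr (b - 1) + d * ((t - \<tau>) powr (b - 1) * w \<tau>))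
      = (\<lambda>\<tau>. (t - \<tau>) powr (b - 1) * (c + d * w \<tau>))" by (auto simp: algebra_simps)
  ultimately have "((\<lambda>\<tau>. (t - \<tau>) powr (b - 1) * (c + d * w \<tau>)) has_integral
      c * (((t - 0) powr b - (t - t) powr b) / b) + d * abel b w t) {0..t}" by simp
  from integral_unique[OF this] show ?thesis by (simp add: abel_def[of b "\<lambda>\<tau>. c + d * w \<tau>"])
qed

text \<open>Where the density vanishes, Hoelder continuity of order \<open>a\<close> improves to
  little-o from the left. On a short interval before \<open>T\<close> the density is at most
  \<open>e\<close>; the part of the integral further away changes by O(u), which is small against
  \<open>u powr a\<close>.\<close>

lemma abel_contact_little_o:
  fixes a :: real
  assumes a: "0 < a" "a < 1" and T: "0 < T" and g: "continuous_on {0..T} g" "g T = 0" and e: "0 < e"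
  obtains h where "0 < h" "h < T" "\<And>\<tau>. \<tau> \<in> {T - h..T} \<Longrightarrow> \<bar>g \<tau>\<bar> \<le> e"
    "\<And>u. u \<in> {0<..h} \<Longrightarrow> \<bar>abel a g T - abel a g (T - u)\<bar> \<le> 3 * e * u powr a / a"
proof -
  obtain C where C: "0 < C" "\<And>\<tau>. \<tau> \<in> {0..T} \<Longrightarrow> \<bar>g \<tau>\<bar> \<le> C"
    using continuous_on_bounded_Icc[OF g(1)] by blast
  obtain d' where d': "d' > 0" "\<And>\<tau>. \<tau> \<in> {0..T} \<Longrightarrow> dist \<tau> T < d' \<Longrightarrow> dist (g \<tau>) (g T) < e"
    using g(1) e T unfolding continuous_on_iff by (metis atLeastAtMost_iff less_imp_le order_refl)
  \<comment> \<open>The half turns the strict bound on the distance into one valid on the closed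
    interval \<open>{T - d..T}\<close>.\<close>
  define d where "d = min T (d' / 2)"
  have d: "0 < d" "d \<le> T" "\<And>\<tau>. \<tau> \<in> {T - d..T} \<Longrightarrow> \<bar>g \<tau>\<bar> \<le> e"
  proof -
    show "0 < d" "d \<le> T" using T d' by (auto simp: d_def)
    show "\<bar>g \<tau>\<bar> \<le> e" if "\<tau> \<in> {T - d..T}" for \<tau>
    proof -
      have "d \<le> d' / 2" by (simp add: d_def)
      thus ?thesis using d'(2)[of \<tau>] that \<open>d \<le> T\<close> d'(1) g(2) by (auto simp: dist_real_def)
    qed
  qed
  \<comment> \<open>Chosen so that \<open>C * a * (d / 2) powr (a - 1) * r = e\<close>. For
    \<open>u\<close> up to \<open>h\<close> then \<open>u \<le> r * u powr a\<close>, which converts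
    the linear bound on the far part into \<open>e * u powr a\<close>.\<close>
  define r where "r = e / (C * a * (d / 2) powr (a - 1))"
  have r: "r > 0" using e C a d by (simp add: r_def)
  define h where "h = min (d / 2) (r powr (1 / (1 - a)))"
  have h: "0 < h" "h \<le> d / 2" "h \<le> r powr (1 / (1 - a))" using d r by (auto simp: h_def)
  have hr: "u powr (1 - a) \<le> r" if "u \<in> {0<..h}" for u
  proof -
    have "u powr (1 - a) \<le> (r powr (1 / (1 - a))) powr (1 - a)"
      using that h a by (intro powr_mono2) auto
    thus ?thesis using a r by (simp add: powr_powr)
  qed
  show ?thesis
  proof (rule that[of h])
    show "0 < h" "h < T" using h d by auto
    show "\<bar>g \<tau>\<bar> \<le> e" if "\<tau> \<in> {T - h..T}" for \<tau>
      using that h d(1) by (intro d(3)) auto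
    show "\<bar>abel a g T - abel a g (T - u)\<bar> \<le> 3 * e * u powr a / a" if u: "u \<in> {0<..h}" for u
    proof -
      define s where "s = T - u"
      have s: "T - d < s" "s < T" "0 \<le> T - d" "u \<le> d / 2" "0 < u" using u h d by (auto simp: s_def)
      have split: "abel a g t = integral {0..T-d} (\<lambda>\<tau>. (t - \<tau>) powr (a - 1) * g \<tau>)
          + integral {T-d..t} (\<lambda>\<tau>. (t - \<tau>) powr (a - 1) * g \<tau>)" if "t \<in> {T-d..T}" for t
        unfolding abel_def using that s a g(1)
        by (intro Henstock_Kurzweil_Integration.integral_combine[symmetric] integrable_abel)
           (auto intro: continuous_on_subset)
      have "\<bar>integral {0..T-d} (\<lambda>\<tau>. (T - \<tau>) powr (a - 1) * g \<tau>) - integral {0..T-d} (\<lambda>\<tau>. (s - \<tau>) powr (a - 1) * g \<tau>)\<bar>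
          \<le> C * (((T - (T - d)) powr a - (s - (T - d)) powr a) / a)"
        using a s C(2) g(1) d(1) by (intro abs_integral_abel_diff_le) (auto intro: continuous_on_subset)
      also have "\<dots> \<le> e * u powr a / a"
      proof -
        \<comment> \<open>Since \<open>u \<le> d / 2\<close>, the tangent slope at
          \<open>d - u\<close> is at most the one at \<open>d / 2\<close>, a bound uniform in
          \<open>u\<close>.\<close>
        have "d powr a - (d - u) powr a \<le> a * (d - u) powr (a - 1) * (d - (d - u))"
          using a s d by (intro powr_diff_tangent_bounds) auto
        also have "\<dots> \<le> a * (d / 2) powr (a - 1) * u"
          using a s d by (auto intro!: mult_left_mono mult_right_mono powr_mono2')
        also have "a * (d / 2) powr (a - 1) * u = a * (d / 2) powr (a - 1) * (u powr (1 - a) * u powr a)"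
          using s by (simp flip: powr_add)
        also have "a * (d / 2) powr (a - 1) * (u powr (1 - a) * u powr a) \<le> a * (d / 2) powr (a - 1) * (r * u powr a)"
          using hr[OF u] a by (auto intro!: mult_left_mono mult_right_mono)
        finally have "C * (d powr a - (d - u) powr a) \<le> C * (a * (d / 2) powr (a - 1) * (r * u powr a))"
          using C by (intro mult_left_mono) auto
        also have "\<dots> = e * u powr a" using C a d by (simp add: r_def field_simps)
        finally show ?thesis using a by (simp add: s_def divide_right_mono)
      qed
      finally have 1: "\<bar>integral {0..T-d} (\<lambda>\<tau>. (T - \<tau>) powr (a - 1) * g \<tau>) - integral {0..T-d} (\<lambda>\<tau>. (s - \<tau>) powr (a - 1) * g \<tau>)\<bar>
          \<le> e * u powr a / a" .
      have 2: "\<bar>integral {T-d..T} (\<lambda>\<tau>. (T - \<tau>) powr (a - 1) * g \<tau>) - integral {T-d..s} (\<lambda>\<tau>. (s - \<tau>) powr (a - 1) * g \<tau>)\<bar>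
          \<le> 2 * e * (T - s) powr a / a"
        using a s d(3) g(1) by (intro abs_integral_abel_holder) (auto intro: continuous_on_subset)
      have 3: "T - s = u" "3 * e * u powr a / a = e * u powr a / a + 2 * e * u powr a / a"
        by (auto simp: s_def field_simps)
      show ?thesis
        using 1 2 split[of T] split[of s] s d(1) unfolding 3 s_def[symmetric] by simp
    qed
  qed
qed

text \<open>On \<open>{0..T - h}\<close> the larger upper argument only shrinks the kernel, and
  \<open>v\<close> is nonnegative, so this part does not grow. On the rest the growth bound on
  \<open>v\<close> cancels the singularity, leaving an integrand of at most
  \<open>K\<close>.\<close>

lemma abel_increment_le:
  fixes b :: real
  assumes b: "0 < b" "b < 1" and h: "0 < h" "h < T" and v: "continuous_on {0..T} v"
    and v0: "\<And>t. t \<in> {0..T} \<Longrightarrow> 0 \<le> v t"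
    and vK: "\<And>u. u \<in> {0<..h} \<Longrightarrow> v (T - u) \<le> K * u powr (1 - b)" and K: "0 \<le> K"
  shows "abel b v T - abel b v (T - h) \<le> K * h"
proof -
  have c: "continuous_on {0..T - h} v" "continuous_on {T - h..T} v"
    using v h by (auto intro: continuous_on_subset)
  have "integral {0..T - h} (\<lambda>\<tau>. (T - \<tau>) powr (b - 1) * v \<tau>) + integral {T - h..T} (\<lambda>\<tau>. (T - \<tau>) powr (b - 1) * v \<tau>)
     = abel b v T"
    unfolding abel_def using b h v
    by (intro Henstock_Kurzweil_Integration.integral_combine integrable_abel) auto
  moreover have "integral {0..T - h} (\<lambda>\<tau>. (T - \<tau>) powr (b - 1) * v \<tau>) \<le> abel b v (T - h)"
    \<comment> \<open>At the endpoint \<open>T - h\<close> the kernel on the right is 0 by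
      convention, so the comparison of kernels is valid only in the interior.\<close>
    unfolding abel_def integral_open_interval_real
  proof (rule integral_le)
    show "(\<lambda>\<tau>. (T - \<tau>) powr (b - 1) * v \<tau>) integrable_on {0<..<T - h}"
      "(\<lambda>\<tau>. (T - h - \<tau>) powr (b - 1) * v \<tau>) integrable_on {0<..<T - h}"
      unfolding integrable_on_Icc_iff_Ioo[symmetric] using b h c by (auto intro!: integrable_abel)
    show "(T - x) powr (b - 1) * v x \<le> (T - h - x) powr (b - 1) * v x" if "x \<in> {0<..<T - h}" for x
      using that b h v0[of x] by (intro mult_right_mono powr_mono2') auto
  qed
  moreover have "integral {T - h..T} (\<lambda>\<tau>. (T - \<tau>) powr (b - 1) * v \<tau>) \<le> integral {T - h..T} (\<lambda>_. K)"
  proof (rule integral_le)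
    show "(\<lambda>\<tau>. (T - \<tau>) powr (b - 1) * v \<tau>) integrable_on {T - h..T}"
      using b h c by (auto intro!: integrable_abel)
    show "(T - x) powr (b - 1) * v x \<le> K" if x: "x \<in> {T - h..T}" for x
    proof (cases "x = T")
      case False
      hence "(T - x) powr (b - 1) * v x \<le> (T - x) powr (b - 1) * (K * (T - x) powr (1 - b))"
        using vK[of "T - x"] x by (intro mult_left_mono) auto
      also have "\<dots> = K * (T - x) powr ((b - 1) + (1 - b))" unfolding powr_add by simp
      also have "\<dots> = K" using False x by simp
      finally show ?thesis .
    qed (use K in auto)
  qed auto
  ultimately show ?thesis using h by (simp add: mult.commute)
qed

text \<open>Suppose \<open>g T = 0\<close>. The increment of \<open>abel (1 - a) v\<close> over
  \<open>{T - h..T}\<close> is then at most a small multiple of \<open>h\<close>, because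
  \<open>v\<close> is little-o of order \<open>a\<close> at \<open>T\<close>. The inversion formula
  bounds it below by \<open>v0 * T powr (- a) * h\<close> up to another small multiple of
  \<open>h\<close>. This is impossible as \<open>v0 > 0\<close>.\<close>

lemma abel_contact_density_neq_0:
  fixes a :: real
  assumes a: "0 < a" "a < 1" and T: "0 < T" and g: "continuous_on {0..T} g" and v0: "0 < v0"
    and v: "\<And>t. t \<in> {0..T} \<Longrightarrow> v t = v0 + abel a g t / Gamma a"
    and nonneg: "\<And>t. t \<in> {0..T} \<Longrightarrow> 0 \<le> v t" and vT: "v T = 0"
  shows "g T \<noteq> 0"
proof
  assume gT: "g T = 0"
  have G: "Gamma a > 0" "Gamma (1 - a) > 0" using a by (auto intro!: Gamma_real_pos)
  define K where "K = 3 / (a * Gamma a)"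
  have K: "K > 0" using G a by (simp add: K_def)
  \<comment> \<open>Makes \<open>(K + Gamma (1 - a)) * e\<close>, the sum of both error terms per
    unit of \<open>h\<close>, half of \<open>v0 * T powr (- a)\<close>.\<close>
  define e where "e = v0 * T powr (- a) / (2 * (K + Gamma (1 - a)))"
  have e: "e > 0" using v0 T K G by (simp add: e_def add_pos_pos)
  obtain h where h: "0 < h" "h < T" "\<And>\<tau>. \<tau> \<in> {T - h..T} \<Longrightarrow> \<bar>g \<tau>\<bar> \<le> e"
    "\<And>u. u \<in> {0<..h} \<Longrightarrow> \<bar>abel a g T - abel a g (T - u)\<bar> \<le> 3 * e * u powr a / a"
    using abel_contact_little_o[OF a T g gT e] by metis
  have vc: "continuous_on {0..T} v"
  proof -
    have "continuous_on {0..T} (\<lambda>t. v0 + abel a g t / Gamma a)"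
      unfolding divide_inverse using a g by (intro continuous_intros continuous_on_abel) auto
    thus ?thesis by (rule continuous_on_eq) (use v in auto)
  qed
  have vK: "v (T - u) \<le> (K * e) * u powr (1 - (1 - a))" if u: "u \<in> {0<..h}" for u
  proof -
    have "v (T - u) = v (T - u) - v T" using vT by simp
    also have "\<dots> = (abel a g (T - u) - abel a g T) / Gamma a"
      using v[of T] v[of "T - u"] u h T by (simp add: diff_divide_distrib)
    also have "\<dots> \<le> (3 * e * u powr a / a) / Gamma a"
      using h(4)[OF u] G by (intro divide_right_mono) auto
    finally show ?thesis by (simp add: K_def)
  qed
  \<comment> \<open>Applying the operator of order \<open>1 - a\<close> turns the singular integral
    of \<open>g\<close> into an ordinary one.\<close>
  have L: "abel (1 - a) v t = v0 * t powr (1 - a) / (1 - a) + Gamma (1 - a) * integral {0..t} g"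
    if t: "t \<in> {0..T}" for t
  proof -
    have gt: "continuous_on {0..t} g" using g t by (auto intro: continuous_on_subset)
    have "abel (1 - a) v t = abel (1 - a) (\<lambda>\<tau>. v0 + 1 / Gamma a * abel a g \<tau>) t"
      unfolding abel_def[of "1 - a"] using v t by (intro integral_cong) auto
    also have "\<dots> = v0 * t powr (1 - a) / (1 - a) + 1 / Gamma a * abel (1 - a) (abel a g) t"
      using a t gt by (intro abel_affine continuous_on_abel) auto
    also have "abel (1 - a) (abel a g) t = Gamma a * Gamma (1 - a) * integral {0..t} g"
      using a t gt by (intro abel_inverse) auto
    finally show ?thesis using G by simp
  qed
  have "abel (1 - a) v T - abel (1 - a) v (T - h) \<le> (K * e) * h"
    using a h vc nonneg vK K e by (intro abel_increment_le) auto
  moreover have "integral {0..T - h} g + integral {T - h..T} g = integral {0..T} g"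
    using h g by (intro Henstock_Kurzweil_Integration.integral_combine integrable_continuous_interval) auto
  hence "Gamma (1 - a) * integral {0..T} g
      = Gamma (1 - a) * integral {0..T - h} g + Gamma (1 - a) * integral {T - h..T} g"
    by (simp flip: distrib_left)
  moreover have "integral {T - h..T} (\<lambda>_. - e) \<le> integral {T - h..T} g"
    using h g by (intro integral_le integrable_continuous_interval)
      (auto intro: continuous_on_subset simp: abs_le_iff minus_le_iff)
  \<comment> \<open>Concavity of the power \<open>1 - a\<close>: the secant slope is at least the
    tangent slope at the right end \<open>T\<close>.\<close>
  moreover have "h * T powr (- a) \<le> (T powr (1 - a) - (T - h) powr (1 - a)) / (1 - a)"
    using powr_diff_tangent_bounds(2)[of "1 - a" "T - h" T] a h
    by (simp add: pos_le_divide_eq mult.commute mult.left_commute)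
  hence "v0 * (h * T powr (- a)) \<le> v0 * ((T powr (1 - a) - (T - h) powr (1 - a)) / (1 - a))"
    using v0 by (intro mult_left_mono) auto
  moreover have "Gamma (1 - a) * (- (e * h)) \<le> Gamma (1 - a) * integral {T - h..T} g"
    using calculation(3) G h by (intro mult_left_mono) (auto simp: mult.commute)
  ultimately have "v0 * (h * T powr (- a)) + Gamma (1 - a) * (- (e * h)) \<le> K * e * h"
    using L[of T] L[of "T - h"] h T by (simp add: algebra_simps diff_divide_distrib)
  hence "h * (v0 * T powr (- a)) \<le> h * ((K + Gamma (1 - a)) * e)" by (simp add: algebra_simps)
  hence "v0 * T powr (- a) \<le> (K + Gamma (1 - a)) * e" using h by simp
  also have "\<dots> = v0 * T powr (- a) / 2" using K G by (simp add: e_def field_simps)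
  finally show False using v0 T by simp
qed

text \<open>Subtracting a constant from the density reduces the general case to a vanishing density.\<close>

lemma abel_contact_density_neg:
  fixes a :: real
  assumes a: "0 < a" "a < 1" and T: "0 < T" and g: "continuous_on {0..T} g" and v0: "0 < v0"
    and v: "\<And>t. t \<in> {0..T} \<Longrightarrow> v t = v0 + abel a g t / Gamma a"
    and nonneg: "\<And>t. t \<in> {0..T} \<Longrightarrow> 0 \<le> v t" and vT: "v T = 0"
  shows "g T < 0"
proof (rule ccontr)
  assume "\<not> g T < 0"
  \<comment> \<open>\<open>c * t powr a\<close> is the Riemann-Liouville integral of the constant
    \<open>g T\<close>. Adding \<open>c * (T powr a - t powr a)\<close> to \<open>v\<close> keeps it
    nonnegative with value 0 at \<open>T\<close>, while its density becomes
    \<open>g - g T\<close>.\<close>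
  define c where "c = g T / (a * Gamma a)"
  have G: "Gamma a > 0" using a by (auto intro!: Gamma_real_pos)
  have c: "0 \<le> c" using \<open>\<not> g T < 0\<close> a G by (simp add: c_def)
  have le: "t powr a \<le> T powr a" if "t \<in> {0..T}" for t using that a by (intro powr_mono2) auto
  have "(\<lambda>\<tau>. - g T + 1 * g \<tau>) T \<noteq> 0"
  proof (rule abel_contact_density_neq_0[OF a T, where g = "\<lambda>\<tau>. - g T + 1 * g \<tau>" and v = "\<lambda>t. v t + c * (T powr a - t powr a)" and ?v0.0 = "v0 + c * T powr a"])
    show "v t + c * (T powr a - t powr a) = v0 + c * T powr a + abel a (\<lambda>\<tau>. - g T + 1 * g \<tau>) t / Gamma a"
      if "t \<in> {0..T}" for t
    proof -
      have "abel a (\<lambda>\<tau>. - g T + 1 * g \<tau>) t = - g T * t powr a / a + 1 * abel a g t"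
        using that a g by (intro abel_affine) (auto intro: continuous_on_subset)
      hence "abel a (\<lambda>\<tau>. - g T + 1 * g \<tau>) t / Gamma a = - (c * t powr a) + abel a g t / Gamma a"
        by (simp add: c_def add_divide_distrib diff_divide_distrib)
      thus ?thesis using v[OF that] by (simp add: algebra_simps)
    qed
    show "0 \<le> v t + c * (T powr a - t powr a)" if "t \<in> {0..T}" for t
      using nonneg[OF that] le[OF that] c by simp
  qed (use v0 c vT g in \<open>auto intro!: continuous_intros add_pos_nonneg\<close>)
  thus False by simp
qed

section \<open>Solutions on a compact interval\<close>

text \<open>Here \<open>g\<close> is the Caputo derivative of \<open>v\<close>. Keeping it as a
  separate argument makes the notion closed under differences and multiples, which solutions of the
  nonlinear equation are not.\<close>

definition abel_primitive :: "real \<Rightarrow> real \<Rightarrow> (real \<Rightarrow> real) \<Rightarrow> (real \<Rightarrow> real) \<Rightarrow> bool" where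
  "abel_primitive a T v g \<longleftrightarrow>
     continuous_on {0..T} g \<and> (\<forall>t\<in>{0..T}. v t = v 0 + abel a g t / Gamma a)"

lemma abel_primitive_continuous:
  assumes "0 < a" "a < 1" "abel_primitive a T v g"
  shows "continuous_on {0..T} v"
proof -
  have "continuous_on {0..T} (\<lambda>t. v 0 + abel a g t / Gamma a)"
    unfolding divide_inverse using assms
    by (intro continuous_intros continuous_on_abel) (auto simp: abel_primitive_def)
  thus ?thesis by (rule continuous_on_eq) (metis assms(3) abel_primitive_def)
qed

lemma abel_primitive_diff:
  assumes "0 < a" "abel_primitive a T v g" "abel_primitive a T w k"
  shows "abel_primitive a T (\<lambda>t. v t - w t) (\<lambda>t. g t - k t)"
proof -
  have c: "continuous_on {0..T} g" "continuous_on {0..T} k"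
    using assms unfolding abel_primitive_def by blast+
  have "abel a (\<lambda>t. g t - k t) t = abel a g t - abel a k t" if "t \<in> {0..T}" for t
    unfolding abel_def right_diff_distrib using assms(1) c that
    by (intro integral_diff integrable_abel) (auto intro: continuous_on_subset)
  hence "v t - w t = (v 0 - w 0) + abel a (\<lambda>t. g t - k t) t / Gamma a" if "t \<in> {0..T}" for t
    using assms(2,3) that unfolding abel_primitive_def by (smt (verit) diff_divide_distrib)
  thus ?thesis unfolding abel_primitive_def using c by (blast intro: continuous_on_diff)
qed

lemma abel_primitive_cmult:
  assumes "abel_primitive a T v g"
  shows "abel_primitive a T (\<lambda>t. c * v t) (\<lambda>t. c * g t)"
proof -
  have "abel a (\<lambda>t. c * g t) t = c * abel a g t" for t
    unfolding abel_def by (subst integral_mult_right[symmetric]) (simp add: mult.left_commute)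
  hence "c * v t = c * v 0 + abel a (\<lambda>t. c * g t) t / Gamma a" if "t \<in> {0..T}" for t
    using assms that unfolding abel_primitive_def by (metis distrib_left times_divide_eq_right)
  thus ?thesis using assms unfolding abel_primitive_def by (blast intro: continuous_on_mult_left)
qed

text \<open>Comparison principle: up to its first zero \<open>v\<close> is nonnegative, so the
  contact lemma makes the density negative there, against \<open>contact\<close>.\<close>

lemma abel_primitive_pos:
  fixes a :: real
  assumes a: "0 < a" "a < 1" and v: "abel_primitive a T v g" and v0: "0 < v 0"
    and contact: "\<And>t. t \<in> {0..T} \<Longrightarrow> v t = 0 \<Longrightarrow> 0 \<le> g t"
    and t: "t \<in> {0..T}"
  shows "0 < v t"
proof (rule ccontr)
  assume "\<not> 0 < v t"
  have vc: "continuous_on {0..T} v" using abel_primitive_continuous[OF a v] .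
  \<comment> \<open>A nonpositive value forces an earlier or simultaneous zero by the intermediate
    value theorem. This gives both the existence of a zero and the sign before the first
    one.\<close>
  have zero: "\<exists>r\<in>{0..s}. v r = 0" if "s \<in> {0..T}" "v s \<le> 0" for s
  proof -
    have "continuous_on {0..s} v" using vc that(1) by (auto intro: continuous_on_subset)
    thus ?thesis using IVT2'[of v s 0 0] that v0 by fastforce
  qed
  define Z where "Z = {0..T} \<inter> v -` {0}"
  have "Z \<noteq> {}" using zero[OF t] \<open>\<not> 0 < v t\<close> t unfolding Z_def by fastforce
  moreover have "compact Z"
    unfolding Z_def using vc
    by (auto simp: compact_eq_bounded_closed intro: continuous_closed_preimage)
  ultimately obtain r where r: "r \<in> Z" "\<And>s. s \<in> Z \<Longrightarrow> r \<le> s"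
    using compact_attains_inf by metis
  have rT: "0 < r" "r \<le> T" "v r = 0"
    using r(1) v0 unfolding Z_def by (auto simp: le_less)
  have nonneg: "0 \<le> v s" if s: "s \<in> {0..r}" for s
  proof (rule ccontr)
    assume "\<not> 0 \<le> v s"
    then obtain q where "q \<in> {0..s}" "v q = 0" using zero[of s] s rT by auto
    hence "q \<in> Z" using s rT by (auto simp: Z_def)
    hence "s = r" using r(2)[of q] \<open>q \<in> {0..s}\<close> s by auto
    thus False using \<open>\<not> 0 \<le> v s\<close> rT by simp
  qed
  have "g r < 0"
  proof (rule abel_contact_density_neg[where v = v, OF a rT(1) _ v0 _ _ rT(3)])
    have "continuous_on {0..T} g" using v by (simp add: abel_primitive_def)
    thus "continuous_on {0..r} g" by (rule continuous_on_subset) (use rT in auto)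
    have "s \<in> {0..T}" if "s \<in> {0..r}" for s using that rT by auto
    thus "v s = v 0 + abel a g s / Gamma a" if "s \<in> {0..r}" for s
      using v that unfolding abel_primitive_def by blast
    show "0 \<le> v s" if "s \<in> {0..r}" for s using that by (rule nonneg)
  qed
  thus False using contact[of r] rT by auto
qed

section \<open>The Volterra equation: unique solvability and two-sided bounds\<close>

lemma continuous_on_compose_rhs:
  assumes "continuous_on (J \<times> UNIV) (\<lambda>(t, x). f t x)" "continuous_on S x" "S \<subseteq> J"
  shows "continuous_on S (\<lambda>\<tau>. f \<tau> (x \<tau>))"
proof -
  have "continuous_on S (\<lambda>\<tau>. (\<lambda>(t, x). f t x) (\<tau>, x \<tau>))"
    using assms by (intro continuous_on_compose2[OF assms(1)] continuous_intros) auto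
  thus ?thesis by simp
qed

lemma caputo_solution_Icc_iff:
  assumes "0 < a" "continuous_on ({0..T} \<times> UNIV) (\<lambda>(t, x). f t x)"
  shows "caputo_solution a f {0..T} x \<longleftrightarrow>
    continuous_on {0..T} x \<and> (\<forall>t\<in>{0..T}. x t = x 0 + abel a (\<lambda>\<tau>. f \<tau> (x \<tau>)) t / Gamma a)"
proof -
  have "(\<lambda>\<tau>. (t - \<tau>) powr (a - 1) * f \<tau> (x \<tau>)) integrable_on {0..t}"
    if "continuous_on {0..T} x" "t \<in> {0..T}" for t
    using that assms by (intro integrable_abel continuous_on_compose_rhs[OF assms(2)]) (auto intro: continuous_on_subset)
  thus ?thesis unfolding caputo_solution_def abel_def by auto
qed

lemma caputo_solution_abel_primitive:
  assumes "0 < a" "continuous_on ({0..T} \<times> UNIV) (\<lambda>(t, x). f t x)" "caputo_solution a f {0..T} x"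
  shows "abel_primitive a T x (\<lambda>\<tau>. f \<tau> (x \<tau>))"
proof -
  have "continuous_on {0..T} x" "\<forall>t\<in>{0..T}. x t = x 0 + abel a (\<lambda>\<tau>. f \<tau> (x \<tau>)) t / Gamma a"
    using assms caputo_solution_Icc_iff[OF assms(1,2)] by blast+
  thus ?thesis
    unfolding abel_primitive_def using continuous_on_compose_rhs[OF assms(2)] by blast
qed

text \<open>In logarithms this is \<open>b * ln y \<le> y\<close>. It trades exponential decay for a
  power with any exponent below 1.\<close>

lemma exp_minus_le_powr:
  fixes y b :: real
  assumes "0 < y" "0 < b" "b < 1"
  shows "exp (- y) \<le> y powr (- b)"
proof -
  have "b * ln y \<le> y"
  proof (cases "0 \<le> ln y")
    case True
    hence "b * ln y \<le> 1 * ln y" using assms by (intro mult_right_mono) auto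
    thus ?thesis using ln_le_minus_one[of y] assms by simp
  next
    case False
    thus ?thesis using assms mult_pos_neg[of b "ln y"] by linarith
  qed
  thus ?thesis using assms by (simp add: powr_def)
qed

text \<open>Half of the order is spent on the weight: \<open>exp (- l * (t - \<tau>))\<close> is at
  most \<open>(l * (t - \<tau>)) powr (- (a / 2))\<close>. The kernel becomes
  \<open>(t - \<tau>) powr (a / 2 - 1)\<close>, still integrable, and the factor
  \<open>l powr (- (a / 2))\<close> is small for large \<open>l\<close>.\<close>

lemma abs_abel_le_exp:
  fixes a :: real
  assumes a: "0 < a" "a < 1" and l: "0 < l" and t: "t \<in> {0..T}" and g: "continuous_on {0..t} g"
    and C: "0 \<le> C" "\<And>\<tau>. \<tau> \<in> {0..t} \<Longrightarrow> \<bar>g \<tau>\<bar> \<le> C * exp (l * \<tau>)"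
  shows "\<bar>abel a g t\<bar> \<le> C * exp (l * t) * (l powr (- (a / 2)) * (T powr (a / 2) / (a / 2)))"
proof -
  define A where "A = C * exp (l * t) * l powr (- (a / 2))"
  have A: "0 \<le> A" using C by (simp add: A_def)
  have h: "((\<lambda>\<tau>. A * (t - \<tau>) powr (a / 2 - 1)) has_integral A * (((t - 0) powr (a / 2) - (t - t) powr (a / 2)) / (a / 2))) {0..t}"
    using a t by (intro has_integral_mult_right has_integral_abel_kernel) auto
  have "norm (abel a g t) \<le> integral {0..t} (\<lambda>\<tau>. A * (t - \<tau>) powr (a / 2 - 1))"
    unfolding abel_def
  proof (rule integral_norm_bound_integral)
    show "(\<lambda>\<tau>. (t - \<tau>) powr (a - 1) * g \<tau>) integrable_on {0..t}"
      using a g by (intro integrable_abel) auto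
    show "(\<lambda>\<tau>. A * (t - \<tau>) powr (a / 2 - 1)) integrable_on {0..t}" using h by (rule has_integral_integrable)
    show "norm ((t - \<tau>) powr (a - 1) * g \<tau>) \<le> A * (t - \<tau>) powr (a / 2 - 1)" if \<tau>: "\<tau> \<in> {0..t}" for \<tau>
    proof (cases "\<tau> = t")
      case False
      hence "\<tau> < t" using \<tau> by simp
      have "exp (l * \<tau>) = exp (l * t) * exp (- (l * (t - \<tau>)))" by (simp flip: exp_add add: algebra_simps)
      also have "\<dots> \<le> exp (l * t) * (l * (t - \<tau>)) powr (- (a / 2))"
        using l a \<open>\<tau> < t\<close> by (intro mult_left_mono exp_minus_le_powr) auto
      also have "\<dots> = exp (l * t) * l powr (- (a / 2)) * (t - \<tau>) powr (- (a / 2))"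
        using l \<open>\<tau> < t\<close> by (simp add: powr_mult)
      finally have "C * exp (l * \<tau>) \<le> A * (t - \<tau>) powr (- (a / 2))"
        using C(1) unfolding A_def by (metis mult.assoc mult_left_mono)
      hence "(t - \<tau>) powr (a - 1) * \<bar>g \<tau>\<bar> \<le> (t - \<tau>) powr (a - 1) * (A * (t - \<tau>) powr (- (a / 2)))"
        using C(2)[OF \<tau>] by (intro mult_left_mono) auto
      also have "\<dots> = A * (t - \<tau>) powr ((a - 1) + (- (a / 2)))" unfolding powr_add by simp
      also have "(a - 1) + (- (a / 2)) = a / 2 - 1" by (simp add: field_simps)
      finally show ?thesis by (simp add: abs_mult)
    qed auto
  qed
  also have "\<dots> = A * (t powr (a / 2) / (a / 2))" using integral_unique[OF h] a by simp
  also have "\<dots> \<le> A * (T powr (a / 2) / (a / 2))"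
    using a t A by (intro mult_left_mono divide_right_mono powr_mono2) auto
  finally show ?thesis by (simp add: A_def mult_ac)
qed

text \<open>In the norm weighted by \<open>exp (- l t)\<close> the Volterra operator is a contraction for large \<open>l\<close>.\<close>

lemma caputo_contraction:
  fixes a :: real
  assumes a: "0 < a" "a < 1" and T: "0 < T" and M: "0 < M"
    and f: "continuous_on ({0..T} \<times> UNIV) (\<lambda>(t, x). f t x)"
    and lip: "\<And>t x y. t \<in> {0..T} \<Longrightarrow> \<bar>f t x - f t y\<bar> \<le> M * \<bar>x - y\<bar>"
  obtains l where "0 < l"
    "\<And>x y D t. continuous_on {0..T} x \<Longrightarrow> continuous_on {0..T} y \<Longrightarrow> 0 \<le> D \<Longrightarrow>
       (\<And>\<tau>. \<tau> \<in> {0..T} \<Longrightarrow> \<bar>x \<tau> - y \<tau>\<bar> \<le> D * exp (l * \<tau>)) \<Longrightarrow> t \<in> {0..T} \<Longrightarrow>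
       \<bar>abel a (\<lambda>\<tau>. f \<tau> (x \<tau>)) t / Gamma a - abel a (\<lambda>\<tau>. f \<tau> (y \<tau>)) t / Gamma a\<bar> \<le> D / 2 * exp (l * t)"
proof -
  have G: "Gamma a > 0" using a by (auto intro!: Gamma_real_pos)
  define Q where "Q = M * (T powr (a / 2) / (a / 2)) / Gamma a"
  have Q: "Q > 0" using M T a G by (simp add: Q_def)
  \<comment> \<open>Solves \<open>Q * l powr (- (a / 2)) = 1 / 2\<close>, giving contraction
    constant 1/2.\<close>
  define l where "l = (2 * Q) powr (2 / a)"
  have l: "l > 0" using Q by (simp add: l_def)
  have "l powr (- (a / 2)) = (2 * Q) powr (- 1)" using a by (simp add: l_def powr_powr)
  also have "\<dots> = 1 / (2 * Q)" using Q by (simp add: powr_minus_divide)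
  finally have lQ: "Q * l powr (- (a / 2)) = 1 / 2" using Q by simp
  show ?thesis
  proof (rule that[OF l])
    fix x y :: "real \<Rightarrow> real" and D t :: real
    assume xy: "continuous_on {0..T} x" "continuous_on {0..T} y" and D: "0 \<le> D"
      and le: "\<And>\<tau>. \<tau> \<in> {0..T} \<Longrightarrow> \<bar>x \<tau> - y \<tau>\<bar> \<le> D * exp (l * \<tau>)" and t: "t \<in> {0..T}"
    have c: "continuous_on {0..t} (\<lambda>\<tau>. f \<tau> (x \<tau>))" "continuous_on {0..t} (\<lambda>\<tau>. f \<tau> (y \<tau>))"
      using xy t by (auto intro!: continuous_on_compose_rhs[OF f] intro: continuous_on_subset)
    have "abel a (\<lambda>\<tau>. f \<tau> (x \<tau>)) t - abel a (\<lambda>\<tau>. f \<tau> (y \<tau>)) t = abel a (\<lambda>\<tau>. f \<tau> (x \<tau>) - f \<tau> (y \<tau>)) t"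
      unfolding abel_def right_diff_distrib using a c
      by (intro integral_diff[symmetric] integrable_abel) auto
    also have "\<bar>\<dots>\<bar> \<le> (M * D) * exp (l * t) * (l powr (- (a / 2)) * (T powr (a / 2) / (a / 2)))"
    proof (rule abs_abel_le_exp[OF a l t])
      show "continuous_on {0..t} (\<lambda>\<tau>. f \<tau> (x \<tau>) - f \<tau> (y \<tau>))" using c by (intro continuous_intros)
      show "\<bar>f \<tau> (x \<tau>) - f \<tau> (y \<tau>)\<bar> \<le> M * D * exp (l * \<tau>)" if "\<tau> \<in> {0..t}" for \<tau>
      proof -
        have "\<bar>f \<tau> (x \<tau>) - f \<tau> (y \<tau>)\<bar> \<le> M * \<bar>x \<tau> - y \<tau>\<bar>" using that t by (intro lip) auto
        also have "\<dots> \<le> M * (D * exp (l * \<tau>))" using that t M by (intro mult_left_mono le) auto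
        finally show ?thesis by simp
      qed
    qed (use M D in auto)
    finally have "\<bar>abel a (\<lambda>\<tau>. f \<tau> (x \<tau>)) t - abel a (\<lambda>\<tau>. f \<tau> (y \<tau>)) t\<bar> / Gamma a
        \<le> (M * D) * exp (l * t) * (l powr (- (a / 2)) * (T powr (a / 2) / (a / 2))) / Gamma a"
      using G by (intro divide_right_mono) auto
    also have "\<dots> = D * exp (l * t) * (Q * l powr (- (a / 2)))" by (simp add: Q_def)
    also have "\<dots> = D / 2 * exp (l * t)" unfolding lQ by simp
    finally show "\<bar>abel a (\<lambda>\<tau>. f \<tau> (x \<tau>)) t / Gamma a - abel a (\<lambda>\<tau>. f \<tau> (y \<tau>)) t / Gamma a\<bar> \<le> D / 2 * exp (l * t)"
      using G by (simp flip: diff_divide_distrib)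
  qed
qed

text \<open>The maximum of the weighted distance of two solutions with equal initial value is at
  most half of itself, hence 0.\<close>

lemma caputo_solution_Icc_unique:
  fixes a :: real
  assumes a: "0 < a" "a < 1" and T: "0 < T" and M: "0 < M"
    and f: "continuous_on ({0..T} \<times> UNIV) (\<lambda>(t, x). f t x)"
    and lip: "\<And>t x y. t \<in> {0..T} \<Longrightarrow> \<bar>f t x - f t y\<bar> \<le> M * \<bar>x - y\<bar>"
    and x: "caputo_solution a f {0..T} x" and y: "caputo_solution a f {0..T} y" and xy: "x 0 = y 0"
    and t: "t \<in> {0..T}"
  shows "x t = y t"
proof -
  obtain l where l: "0 < l"
    "\<And>x y D t. continuous_on {0..T} x \<Longrightarrow> continuous_on {0..T} y \<Longrightarrow> 0 \<le> D \<Longrightarrow>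
       (\<And>\<tau>. \<tau> \<in> {0..T} \<Longrightarrow> \<bar>x \<tau> - y \<tau>\<bar> \<le> D * exp (l * \<tau>)) \<Longrightarrow> t \<in> {0..T} \<Longrightarrow>
       \<bar>abel a (\<lambda>\<tau>. f \<tau> (x \<tau>)) t / Gamma a - abel a (\<lambda>\<tau>. f \<tau> (y \<tau>)) t / Gamma a\<bar> \<le> D / 2 * exp (l * t)"
    using caputo_contraction[OF a T M f lip] by blast
  have x': "continuous_on {0..T} x" "\<And>t. t \<in> {0..T} \<Longrightarrow> x t = x 0 + abel a (\<lambda>\<tau>. f \<tau> (x \<tau>)) t / Gamma a"
    and y': "continuous_on {0..T} y" "\<And>t. t \<in> {0..T} \<Longrightarrow> y t = y 0 + abel a (\<lambda>\<tau>. f \<tau> (y \<tau>)) t / Gamma a"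
    using x y caputo_solution_Icc_iff[OF a(1) f] by blast+
  define d where "d = (\<lambda>t. \<bar>x t - y t\<bar> * exp (- (l * t)))"
  have "continuous_on {0..T} d" unfolding d_def using x' y' by (intro continuous_intros)
  then obtain s where s: "s \<in> {0..T}" "\<And>t. t \<in> {0..T} \<Longrightarrow> d t \<le> d s"
    using continuous_attains_sup[of "{0..T}" d] T by fastforce
  have d: "\<bar>x t - y t\<bar> = d t * exp (l * t)" for t by (simp add: d_def flip: exp_add)
  have "\<bar>x s - y s\<bar> = \<bar>abel a (\<lambda>\<tau>. f \<tau> (x \<tau>)) s / Gamma a - abel a (\<lambda>\<tau>. f \<tau> (y \<tau>)) s / Gamma a\<bar>"
    using x'(2)[OF s(1)] y'(2)[OF s(1)] xy by linarith
  also have "\<dots> \<le> d s / 2 * exp (l * s)"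
  proof (rule l(2)[OF x'(1) y'(1) _ _ s(1)])
    show "0 \<le> d s" by (simp add: d_def)
    show "\<bar>x \<tau> - y \<tau>\<bar> \<le> d s * exp (l * \<tau>)" if "\<tau> \<in> {0..T}" for \<tau>
      unfolding d using s(2)[OF that] by (rule mult_right_mono) simp
  qed
  finally have "d s * exp (l * s) \<le> d s / 2 * exp (l * s)" unfolding d .
  hence "d s \<le> d s / 2" by (rule mult_right_le_imp_le) simp
  hence "d t \<le> 0" using s(2)[OF t] by linarith
  thus ?thesis by (simp add: d_def mult_le_0_iff)
qed

lemma caputo_solution_Icc_exists:
  fixes a :: real
  assumes a: "0 < a" "a < 1" and T: "0 < T" and M: "0 < M"
    and f: "continuous_on ({0..T} \<times> UNIV) (\<lambda>(t, x). f t x)"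
    and lip: "\<And>t x y. t \<in> {0..T} \<Longrightarrow> \<bar>f t x - f t y\<bar> \<le> M * \<bar>x - y\<bar>"
  obtains x where "caputo_solution a f {0..T} x" "x 0 = x0"
proof -
  obtain l where l: "0 < l"
    "\<And>x y D t. continuous_on {0..T} x \<Longrightarrow> continuous_on {0..T} y \<Longrightarrow> 0 \<le> D \<Longrightarrow>
       (\<And>\<tau>. \<tau> \<in> {0..T} \<Longrightarrow> \<bar>x \<tau> - y \<tau>\<bar> \<le> D * exp (l * \<tau>)) \<Longrightarrow> t \<in> {0..T} \<Longrightarrow>
       \<bar>abel a (\<lambda>\<tau>. f \<tau> (x \<tau>)) t / Gamma a - abel a (\<lambda>\<tau>. f \<tau> (y \<tau>)) t / Gamma a\<bar> \<le> D / 2 * exp (l * t)"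
    using caputo_contraction[OF a T M f lip] by blast
  \<comment> \<open>The weight is moved into the unknown: with \<open>x = E u\<close>, the ordinary
    supremum metric on \<open>u\<close> is the weighted metric on \<open>x\<close>, and Banach's
    theorem applies in the complete space of bounded continuous functions.\<close>
  define E where "E = (\<lambda>(u :: real \<Rightarrow>\<^sub>C real) \<tau>. exp (l * \<tau>) * u \<tau>)"
  have Ec: "continuous_on {0..T} (E u)" for u unfolding E_def by (intro continuous_intros) auto
  define V where "V = (\<lambda>u t. exp (- (l * t)) * (x0 + abel a (\<lambda>\<tau>. f \<tau> (E u \<tau>)) t / Gamma a))"
  \<comment> \<open>Clamping the time to \<open>{0..T}\<close> extends functions from the interval
    to the whole line, where that space is defined.\<close>
  define c where "c = (\<lambda>t. max 0 (min T t))"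
  have c: "c t \<in> {0..T}" for t using T by (auto simp: c_def)
  have c_id: "c t = t" if "t \<in> {0..T}" for t using that by (simp add: c_def min_absorb2)
  have Vc: "continuous_on {0..T} (V u)" for u
    unfolding V_def divide_inverse using a
    by (intro continuous_intros continuous_on_abel continuous_on_compose_rhs[OF f Ec]) auto
  have Vb: "(\<lambda>t. V u (c t)) \<in> bcontfun" for u
  proof -
    obtain C where "\<And>\<tau>. \<tau> \<in> {0..T} \<Longrightarrow> \<bar>V u \<tau>\<bar> \<le> C"
      using continuous_on_bounded_Icc[OF Vc] by metis
    moreover have "continuous_on UNIV (\<lambda>t. V u (c t))"
      using c by (intro continuous_on_compose2[OF Vc]) (auto simp: c_def intro!: continuous_intros)
    ultimately show ?thesis using c by (intro bcontfun_normI[where b = C]) auto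
  qed
  define P where "P = (\<lambda>u. Bcontfun (\<lambda>t. V u (c t)))"
  have P: "P u t = V u (c t)" for u t unfolding P_def by (simp add: Bcontfun_inverse[OF Vb])
  have "\<forall>u w. dist (P u) (P w) \<le> 1 / 2 * dist u w"
  proof (intro allI dist_bound)
    fix u w and t :: real
    have le: "\<bar>E u \<tau> - E w \<tau>\<bar> \<le> dist u w * exp (l * \<tau>)" for \<tau>
      using dist_bounded[of u \<tau> w] by (simp add: E_def abs_mult dist_real_def flip: right_diff_distrib)
    have "dist (P u t) (P w t) = exp (- (l * c t)) *
        \<bar>abel a (\<lambda>\<tau>. f \<tau> (E u \<tau>)) (c t) / Gamma a - abel a (\<lambda>\<tau>. f \<tau> (E w \<tau>)) (c t) / Gamma a\<bar>"
      by (simp add: P V_def dist_real_def abs_mult flip: right_diff_distrib)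
    also have "\<dots> \<le> exp (- (l * c t)) * (dist u w / 2 * exp (l * c t))"
      using c le by (intro mult_left_mono l(2)[OF Ec Ec]) auto
    also have "\<dots> = 1 / 2 * dist u w" by (simp flip: exp_add)
    finally show "dist (P u t) (P w t) \<le> 1 / 2 * dist u w" .
  qed
  then obtain u where u: "P u = u" using banach_fix_type[of "1 / 2" P] by auto
  have "E u t = x0 + abel a (\<lambda>\<tau>. f \<tau> (E u \<tau>)) t / Gamma a" if "t \<in> {0..T}" for t
  proof -
    have "E u t = exp (l * t) * P u t" by (simp add: E_def u)
    thus ?thesis using that by (simp add: P c_id V_def flip: exp_add mult.assoc)
  qed
  moreover from this[of 0] have "E u 0 = x0" using T by (simp add: abel_def)
  ultimately show ?thesis using Ec by (intro that[of "E u"]) (auto simp: caputo_solution_Icc_iff[OF a(1) f])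
qed

text \<open>The difference of two solutions is enclosed between multiples of \<open>z\<close> and
  \<open>w\<close>, the solutions of the linear equations with coefficients \<open>- M\<close> and
  \<open>M\<close> and initial value 1. The minimum of \<open>z\<close> and the maximum of
  \<open>w\<close> yield the constants.\<close>

lemma caputo_solution_Icc_bilipschitz:
  fixes a :: real
  assumes a: "0 < a" "a < 1" and T: "0 < T" and M: "0 < M"
    and f: "continuous_on ({0..T} \<times> UNIV) (\<lambda>(t, x). f t x)"
    and lip: "\<And>t x y. t \<in> {0..T} \<Longrightarrow> \<bar>f t x - f t y\<bar> \<le> M * \<bar>x - y\<bar>"
  obtains c C where "0 < c" "0 < C"
    "\<And>x y t. caputo_solution a f {0..T} x \<Longrightarrow> caputo_solution a f {0..T} y \<Longrightarrow> y 0 < x 0 \<Longrightarrow> t \<in> {0..T} \<Longrightarrow>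
       c * (x 0 - y 0) \<le> x t - y t \<and> x t - y t \<le> C * (x 0 - y 0)"
proof -
  \<comment> \<open>Positivity is the comparison principle with the density \<open>m * w\<close>,
    which is 0 at every zero of \<open>w\<close>.\<close>
  have lin: "\<exists>w. abel_primitive a T w (\<lambda>\<tau>. m * w \<tau>) \<and> w 0 = 1 \<and> (\<forall>t\<in>{0..T}. 0 < w t)"
    if m: "\<bar>m\<bar> = M" for m
  proof -
    have c: "continuous_on ({0..T} \<times> UNIV) (\<lambda>(t :: real, x :: real). m * x)"
      unfolding split_beta by (intro continuous_intros)
    obtain w where w: "caputo_solution a (\<lambda>t x. m * x) {0..T} w" "w 0 = 1"
    proof (rule caputo_solution_Icc_exists[OF a T M c])
      show "\<bar>m * x - m * y\<bar> \<le> M * \<bar>x - y\<bar>" for x y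
        using m by (simp add: abs_mult flip: right_diff_distrib)
    qed
    have p: "abel_primitive a T w (\<lambda>\<tau>. m * w \<tau>)"
      using caputo_solution_abel_primitive[OF a(1) c w(1)] .
    have "0 < w t" if "t \<in> {0..T}" for t
      by (rule abel_primitive_pos[OF a p]) (use that w(2) in auto)
    thus ?thesis using p w by blast
  qed
  obtain w z where w: "abel_primitive a T w (\<lambda>\<tau>. M * w \<tau>)" "w 0 = 1" "\<And>t. t \<in> {0..T} \<Longrightarrow> 0 < w t"
    and z: "abel_primitive a T z (\<lambda>\<tau>. - M * z \<tau>)" "z 0 = 1" "\<And>t. t \<in> {0..T} \<Longrightarrow> 0 < z t"
    using lin[of M] lin[of "- M"] M by (metis abs_minus_cancel abs_of_pos)
  have cw: "continuous_on {0..T} w" "continuous_on {0..T} z"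
    using abel_primitive_continuous[OF a] w z by blast+
  obtain t1 where t1: "t1 \<in> {0..T}" "\<And>t. t \<in> {0..T} \<Longrightarrow> w t \<le> w t1"
    using continuous_attains_sup[of "{0..T}" w] cw T by fastforce
  obtain t2 where t2: "t2 \<in> {0..T}" "\<And>t. t \<in> {0..T} \<Longrightarrow> z t2 \<le> z t"
    using continuous_attains_inf[of "{0..T}" z] cw T by fastforce
  show ?thesis
  \<comment> \<open>The factors 1/2 and 2 create the strict initial inequalities that the comparison
    principle requires.\<close>
  proof (rule that[of "z t2 / 2" "2 * w t1"])
    show "0 < z t2 / 2" "0 < 2 * w t1" using w z t1 t2 by auto
    fix x y t assume x: "caputo_solution a f {0..T} x" and y: "caputo_solution a f {0..T} y"
      and xy: "y 0 < x 0" and t: "t \<in> {0..T}"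
    define D where "D = x 0 - y 0"
    have D: "D > 0" using xy by (simp add: D_def)
    have p: "abel_primitive a T (\<lambda>t. x t - y t) (\<lambda>\<tau>. f \<tau> (x \<tau>) - f \<tau> (y \<tau>))"
      using a caputo_solution_abel_primitive[OF a(1) f] x y by (intro abel_primitive_diff) auto
    have lower: "0 < (x t - y t) - D / 2 * z t"
    proof (rule abel_primitive_pos[where v = "\<lambda>t. (x t - y t) - D / 2 * z t", OF a _ _ _ t])
      show "abel_primitive a T (\<lambda>t. (x t - y t) - D / 2 * z t) (\<lambda>t. (f t (x t) - f t (y t)) - D / 2 * (- M * z t))"
        using a by (intro abel_primitive_diff p abel_primitive_cmult z(1)) auto
      \<comment> \<open>At a contact the difference of the solutions equals
        \<open>D / 2 * z s\<close>, so the Lipschitz bound is exactly what the linear term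
        compensates.\<close>
      show "0 \<le> (f s (x s) - f s (y s)) - D / 2 * (- M * z s)"
        if s: "s \<in> {0..T}" "(x s - y s) - D / 2 * z s = 0" for s
      proof -
        have "0 < D / 2 * z s" using D z(3)[OF s(1)] by simp
        hence "\<bar>x s - y s\<bar> = D / 2 * z s" using s(2) by linarith
        hence "\<bar>f s (x s) - f s (y s)\<bar> \<le> M * (D / 2 * z s)" using lip[OF s(1), of "x s" "y s"] by metis
        moreover have "D / 2 * (- M * z s) = - (M * (D / 2 * z s))" by simp
        ultimately show ?thesis by linarith
      qed
      show "0 < (x 0 - y 0) - D / 2 * z 0" using xy by (simp add: D_def z(2))
    qed
    have upper: "0 < 2 * D * w t - (x t - y t)"
    proof (rule abel_primitive_pos[where v = "\<lambda>t. 2 * D * w t - (x t - y t)", OF a _ _ _ t])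
      show "abel_primitive a T (\<lambda>t. 2 * D * w t - (x t - y t)) (\<lambda>t. 2 * D * (M * w t) - (f t (x t) - f t (y t)))"
        using a by (intro abel_primitive_diff p abel_primitive_cmult w(1)) auto
      show "0 \<le> 2 * D * (M * w s) - (f s (x s) - f s (y s))"
        if s: "s \<in> {0..T}" "2 * D * w s - (x s - y s) = 0" for s
      proof -
        have "0 < 2 * D * w s" using D w(3)[OF s(1)] by simp
        hence "\<bar>x s - y s\<bar> = 2 * D * w s" using s(2) by linarith
        hence "\<bar>f s (x s) - f s (y s)\<bar> \<le> M * (2 * D * w s)" using lip[OF s(1), of "x s" "y s"] by metis
        moreover have "2 * D * (M * w s) = M * (2 * D * w s)" by simp
        ultimately show ?thesis by linarith
      qed
      show "0 < 2 * D * w 0 - (x 0 - y 0)" using xy by (simp add: D_def w(2))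
    qed
    have "z t2 * D \<le> z t * D" "w t * D \<le> w t1 * D" using t1 t2 t D by auto
    hence "z t2 / 2 * D \<le> x t - y t" "x t - y t \<le> 2 * w t1 * D" using lower upper by argo+
    thus "z t2 / 2 * (x 0 - y 0) \<le> x t - y t \<and> x t - y t \<le> 2 * w t1 * (x 0 - y 0)"
      unfolding D_def by blast
  qed
qed

section \<open>The evolution mappings\<close>

lemma caputo_solution_subset:
  assumes "caputo_solution a f J x" "K \<subseteq> J"
  shows "caputo_solution a f K x"
  using assms unfolding caputo_solution_def by (blast intro: continuous_on_subset)

lemma caputo_solution_Icc_cong:
  assumes x: "caputo_solution a f {0..T} x" and T: "0 \<le> T" and xy: "\<And>t. t \<in> {0..T} \<Longrightarrow> x t = y t"
  shows "caputo_solution a f {0..T} y"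
  unfolding caputo_solution_def
proof (intro conjI ballI)
  show "continuous_on {0..T} y"
    using x xy unfolding caputo_solution_def by (blast intro: continuous_on_eq)
  fix t assume t: "t \<in> {0..T}"
  have e: "(t - \<tau>) powr (a - 1) * f \<tau> (x \<tau>) = (t - \<tau>) powr (a - 1) * f \<tau> (y \<tau>)" if "\<tau> \<in> {0..t}" for \<tau>
    using that t xy[of \<tau>] by simp
  have "x 0 = y 0" "x t = y t" using xy T t by auto
  moreover have "integral {0..t} (\<lambda>\<tau>. (t - \<tau>) powr (a - 1) * f \<tau> (x \<tau>))
      = integral {0..t} (\<lambda>\<tau>. (t - \<tau>) powr (a - 1) * f \<tau> (y \<tau>))"
    using e by (rule integral_cong)
  ultimately show "y t = y 0 + 1 / Gamma a * integral {0..t} (\<lambda>\<tau>. (t - \<tau>) powr (a - 1) * f \<tau> (y \<tau>))"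
    using x t unfolding caputo_solution_def by metis
  have "(\<lambda>\<tau>. (t - \<tau>) powr (a - 1) * f \<tau> (x \<tau>)) integrable_on {0..t}"
    using x t unfolding caputo_solution_def by blast
  thus "(\<lambda>\<tau>. (t - \<tau>) powr (a - 1) * f \<tau> (y \<tau>)) integrable_on {0..t}"
    by (rule integrable_eq) (use e in auto)
qed

text \<open>The equation at \<open>t\<close> involves only \<open>{0..t}\<close>, and
  \<open>{0..t + 1}\<close> is a neighbourhood of \<open>t\<close> relative to the half-line, so
  compact intervals decide both clauses.\<close>

lemma caputo_solution_atLeastI:
  assumes "\<And>T. 0 < T \<Longrightarrow> caputo_solution a f {0..T} x"
  shows "caputo_solution a f {0..} x"
proof -
  have "continuous_on {0..} x"
    unfolding continuous_on_eq_continuous_within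
  proof
    fix t :: real assume t: "t \<in> {0..}"
    have "continuous_on {0..t + 1} x" using assms[of "t + 1"] t by (simp add: caputo_solution_def)
    hence "continuous (at t within {0..t + 1}) x" using t by (simp add: continuous_on_eq_continuous_within)
    moreover have "at t within {0..t + 1} = at t within {0..}"
      by (rule at_within_nhd[of _ "{..<t + 1}"]) auto
    ultimately show "continuous (at t within {0..}) x" by simp
  qed
  moreover have "(\<lambda>\<tau>. (t - \<tau>) powr (a - 1) * f \<tau> (x \<tau>)) integrable_on {0..t} \<and>
      x t = x 0 + 1 / Gamma a * integral {0..t} (\<lambda>\<tau>. (t - \<tau>) powr (a - 1) * f \<tau> (x \<tau>))"
    if "t \<in> {0..}" for t
  proof -
    have "t \<in> {0..t + 1}" "0 < t + 1" using that by auto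
    thus ?thesis using assms[of "t + 1"] unfolding caputo_solution_def by blast
  qed
  ultimately show ?thesis unfolding caputo_solution_def by blast
qed

section \<open>Global solutions and evolution mappings on J\<close>

locale caputo_problem =
  fixes \<alpha> :: real and J :: "real set" and f :: "real \<Rightarrow> real \<Rightarrow> real" and L :: "real \<Rightarrow> real"
  assumes alpha: "0 < \<alpha>" "\<alpha> < 1"
    and J: "(\<exists>T>0. J = {0..T}) \<or> J = {0..}"
    and f_cont: "continuous_on (J \<times> UNIV) (\<lambda>(t, x). f t x)"
    and L_cont: "continuous_on J L"
    and lip: "\<And>t x y. t \<in> J \<Longrightarrow> \<bar>f t x - f t y\<bar> \<le> L t * \<bar>x - y\<bar>"
begin

abbreviation \<Phi> :: "real \<Rightarrow> real \<Rightarrow> real" where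
  "\<Phi> \<equiv> evolution0 \<alpha> f J"

lemma Icc_subset_J: "T \<in> J \<Longrightarrow> {0..T} \<subseteq> J"
  using J by auto

text \<open>Reduces both shapes of \<open>J\<close> to compact intervals of positive length: one
  interval catches all times of \<open>J\<close> up to \<open>B\<close>.\<close>

lemma horizon:
  obtains T where "T \<in> J" "0 < T" "\<And>t. t \<in> J \<Longrightarrow> t \<le> B \<Longrightarrow> t \<in> {0..T}"
proof (cases "J = {0..}")
  case True
  show ?thesis by (rule that[of "max 1 B"]) (auto simp: True)
next
  case False
  then obtain T where "0 < T" "J = {0..T}" using J by blast
  thus ?thesis by (intro that[of T]) auto
qed

lemma f_cont_Icc: "T \<in> J \<Longrightarrow> continuous_on ({0..T} \<times> UNIV) (\<lambda>(t, x). f t x)"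
  using f_cont by (rule continuous_on_subset) (use Icc_subset_J in auto)

lemma uniform_lipschitz:
  assumes "T \<in> J"
  obtains M where "0 < M" "\<And>t x y. t \<in> {0..T} \<Longrightarrow> \<bar>f t x - f t y\<bar> \<le> M * \<bar>x - y\<bar>"
proof -
  have "continuous_on {0..T} L" using L_cont Icc_subset_J[OF assms] by (rule continuous_on_subset)
  then obtain M where M: "0 < M" "\<And>t. t \<in> {0..T} \<Longrightarrow> \<bar>L t\<bar> \<le> M"
    using continuous_on_bounded_Icc by metis
  show ?thesis
  proof (rule that[OF M(1)])
    fix t x y assume t: "t \<in> {0..T}"
    hence "\<bar>f t x - f t y\<bar> \<le> L t * \<bar>x - y\<bar>" using Icc_subset_J[OF assms] by (intro lip) auto
    also have "\<dots> \<le> M * \<bar>x - y\<bar>" using M(2)[OF t] by (intro mult_right_mono) auto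
    finally show "\<bar>f t x - f t y\<bar> \<le> M * \<bar>x - y\<bar>" .
  qed
qed

lemma solution_Icc_unique:
  assumes T: "T \<in> J" "0 < T"
    and "caputo_solution \<alpha> f {0..T} x" "caputo_solution \<alpha> f {0..T} y" "x 0 = y 0" "t \<in> {0..T}"
  shows "x t = y t"
proof -
  obtain M where "0 < M" "\<And>t x y. t \<in> {0..T} \<Longrightarrow> \<bar>f t x - f t y\<bar> \<le> M * \<bar>x - y\<bar>"
    using uniform_lipschitz[OF T(1)] by metis
  thus ?thesis
    using caputo_solution_Icc_unique[OF alpha T(2) _ f_cont_Icc[OF T(1)] _ assms(3-6)] by blast
qed

lemma solution_Icc_exists:
  assumes T: "T \<in> J" "0 < T"
  shows "\<exists>x. caputo_solution \<alpha> f {0..T} x \<and> x 0 = x0"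
proof -
  obtain M where "0 < M" "\<And>t x y. t \<in> {0..T} \<Longrightarrow> \<bar>f t x - f t y\<bar> \<le> M * \<bar>x - y\<bar>"
    using uniform_lipschitz[OF T(1)] by metis
  thus ?thesis
    using caputo_solution_Icc_exists[OF alpha T(2) _ f_cont_Icc[OF T(1)]] by metis
qed

lemma solution_unique:
  assumes "caputo_solution \<alpha> f J x" "caputo_solution \<alpha> f J y" "x 0 = y 0" "t \<in> J"
  shows "x t = y t"
proof -
  obtain T where T: "T \<in> J" "0 < T" "t \<in> {0..T}" using horizon[of t] assms(4) by blast
  show ?thesis
    using solution_Icc_unique[where x = x and y = y, OF T(1,2) _ _ assms(3) T(3)] assms(1,2)
      caputo_solution_subset[OF _ Icc_subset_J[OF T(1)]] by blast
qed

text \<open>On the half-line, solutions on compact intervals agree on overlaps by uniqueness and are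
  glued together.\<close>

lemma solution_exists:
  obtains x where "caputo_solution \<alpha> f J x" "x 0 = x0"
proof (cases "J = {0..}")
  case False
  then obtain T where T: "0 < T" "J = {0..T}" using J by blast
  show ?thesis using solution_Icc_exists[of T x0] T that by auto
next
  case True
  have "\<forall>T\<in>{0<..}. \<exists>x. caputo_solution \<alpha> f {0..T} x \<and> x 0 = x0"
    using solution_Icc_exists True by auto
  then obtain X where X: "\<And>T. 0 < T \<Longrightarrow> caputo_solution \<alpha> f {0..T} (X T)" "\<And>T. 0 < T \<Longrightarrow> X T 0 = x0"
    unfolding bchoice_iff by auto
  have mono: "X S t = X T t" if "0 < S" "S \<le> T" "t \<in> {0..S}" for S T t
  proof (rule solution_Icc_unique[of S "X S" "X T"])
    show "caputo_solution \<alpha> f {0..S} (X T)"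
      using that by (intro caputo_solution_subset[OF X(1)[of T]]) auto
  qed (use that True X(1)[of S] X(2)[of S] X(2)[of T] in auto)
  \<comment> \<open>The shift by 1 keeps the horizon positive, also at t = 0.\<close>
  define x where "x = (\<lambda>t. X (t + 1) t)"
  have x: "X T t = x t" if "0 < T" "t \<in> {0..T}" for T t
  proof (cases "T \<le> t + 1")
    case True
    show ?thesis unfolding x_def using that True by (intro mono) auto
  next
    case False
    show ?thesis unfolding x_def using that False by (intro mono[symmetric]) auto
  qed
  have "caputo_solution \<alpha> f {0..} x"
  proof (rule caputo_solution_atLeastI)
    show "caputo_solution \<alpha> f {0..T} x" if "0 < T" for T
      by (rule caputo_solution_Icc_cong[OF X(1)[OF that]]) (use that x in auto)
  qed
  moreover have "x 0 = x0" using X(2)[of 1] by (simp add: x_def)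
  ultimately show ?thesis using that True by simp
qed

text \<open>Uniqueness makes the definite description in \<open>evolution0\<close> denote a value;
  the facts about \<open>\<Phi>\<close> reach solutions through this equation.\<close>

lemma evolution0_solution:
  assumes "caputo_solution \<alpha> f J x" "t \<in> J"
  shows "\<Phi> t (x 0) = x t"
  unfolding evolution0_def
  by (rule the_equality) (use assms solution_unique in blast)+

lemma evolution0_continuous_time: "continuous_on J (\<lambda>t. \<Phi> t p)"
proof -
  obtain x where x: "caputo_solution \<alpha> f J x" "x 0 = p" using solution_exists .
  have "continuous_on J x" using x(1) unfolding caputo_solution_def by blast
  thus ?thesis by (rule continuous_on_eq) (use evolution0_solution[OF x(1)] x(2) in auto)
qed

text \<open>The constants do not depend on the time in \<open>{0..T}\<close>, which joint continuity
  will need. The signed form also carries monotonicity.\<close>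

lemma evolution0_bilipschitz:
  assumes T: "T \<in> J" "0 < T"
  obtains c C where "0 < c" "0 < C"
    "\<And>t p q. t \<in> {0..T} \<Longrightarrow> q < p \<Longrightarrow> c * (p - q) \<le> \<Phi> t p - \<Phi> t q \<and> \<Phi> t p - \<Phi> t q \<le> C * (p - q)"
proof -
  obtain M where M: "0 < M" "\<And>t x y. t \<in> {0..T} \<Longrightarrow> \<bar>f t x - f t y\<bar> \<le> M * \<bar>x - y\<bar>"
    using uniform_lipschitz[OF T(1)] by metis
  obtain c C where c: "0 < c" "0 < C"
    "\<And>x y t. caputo_solution \<alpha> f {0..T} x \<Longrightarrow> caputo_solution \<alpha> f {0..T} y \<Longrightarrow> y 0 < x 0 \<Longrightarrow> t \<in> {0..T} \<Longrightarrow>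
       c * (x 0 - y 0) \<le> x t - y t \<and> x t - y t \<le> C * (x 0 - y 0)"
    using caputo_solution_Icc_bilipschitz[OF alpha T(2) M(1) f_cont_Icc[OF T(1)] M(2)] by blast
  show ?thesis
  proof (rule that[OF c(1,2)])
    fix t p q :: real assume t: "t \<in> {0..T}" and "q < p"
    obtain x where x: "caputo_solution \<alpha> f J x" "x 0 = p" using solution_exists .
    obtain y where y: "caputo_solution \<alpha> f J y" "y 0 = q" using solution_exists .
    have "t \<in> J" using t Icc_subset_J[OF T(1)] by auto
    hence "\<Phi> t p = x t" "\<Phi> t q = y t" using evolution0_solution x y by auto
    thus "c * (p - q) \<le> \<Phi> t p - \<Phi> t q \<and> \<Phi> t p - \<Phi> t q \<le> C * (p - q)"
      using c(3)[of x y t] x y t \<open>q < p\<close> caputo_solution_subset Icc_subset_J[OF T(1)] by metis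
  qed
qed

lemma evolution0_abs_bilipschitz:
  assumes T: "T \<in> J" "0 < T"
  obtains c C where "0 < c" "0 < C"
    "\<And>t p q. t \<in> {0..T} \<Longrightarrow> c * \<bar>p - q\<bar> \<le> \<bar>\<Phi> t p - \<Phi> t q\<bar>"
    "\<And>t p q. t \<in> {0..T} \<Longrightarrow> \<bar>\<Phi> t p - \<Phi> t q\<bar> \<le> C * \<bar>p - q\<bar>"
proof -
  obtain c C where c: "0 < c" "0 < C"
    "\<And>t p q. t \<in> {0..T} \<Longrightarrow> q < p \<Longrightarrow> c * (p - q) \<le> \<Phi> t p - \<Phi> t q \<and> \<Phi> t p - \<Phi> t q \<le> C * (p - q)"
    using evolution0_bilipschitz[OF T] by blast
  have pos: "0 < c * (p - q)" if "q < p" for p q using c(1) that by simp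
  have *: "c * \<bar>p - q\<bar> \<le> \<bar>\<Phi> t p - \<Phi> t q\<bar> \<and> \<bar>\<Phi> t p - \<Phi> t q\<bar> \<le> C * \<bar>p - q\<bar>" if "t \<in> {0..T}" for t p q
  proof (cases p q rule: linorder_cases)
    case less
    thus ?thesis using c(3)[OF that less] pos[OF less] by (simp add: abs_if)
  next
    case greater
    thus ?thesis using c(3)[OF that greater] pos[OF greater] by (simp add: abs_if)
  qed simp
  show ?thesis by (rule that[OF c(1,2)]) (use * in blast)+
qed

text \<open>The lower bound makes \<open>\<Phi> t\<close> strictly increasing and unbounded in both
  directions, the upper bound makes it continuous; surjectivity follows from the intermediate value
  theorem.\<close>

lemma bij_evolution0:
  assumes t: "t \<in> J"
  shows "bij (\<Phi> t)"
proof -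
  obtain T where T: "T \<in> J" "0 < T" "t \<in> {0..T}" using horizon[of t] t by blast
  obtain c C where c: "0 < c" "0 < C"
    "\<And>t p q. t \<in> {0..T} \<Longrightarrow> q < p \<Longrightarrow> c * (p - q) \<le> \<Phi> t p - \<Phi> t q \<and> \<Phi> t p - \<Phi> t q \<le> C * (p - q)"
    using evolution0_bilipschitz[OF T(1,2)] by blast
  have mono: "strict_mono (\<Phi> t)"
  proof (rule strict_monoI)
    fix q p :: real assume "q < p"
    hence "0 < c * (p - q)" using c(1) by simp
    thus "\<Phi> t q < \<Phi> t p" using c(3)[OF T(3) \<open>q < p\<close>] by linarith
  qed
  have cont: "continuous_on UNIV (\<Phi> t)"
  proof -
    obtain c' C' where "0 < C'" "\<And>p q. \<bar>\<Phi> t p - \<Phi> t q\<bar> \<le> C' * \<bar>p - q\<bar>"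
      using evolution0_abs_bilipschitz[OF T(1,2)] T(3) by metis
    hence "C'-lipschitz_on UNIV (\<Phi> t)" by (intro lipschitz_onI) (auto simp: dist_real_def)
    thus ?thesis by (rule lipschitz_on_continuous_on)
  qed
  have "y \<in> range (\<Phi> t)" for y
  proof -
    \<comment> \<open>Then \<open>c * R\<close> exceeds the distance from \<open>y\<close> to
      \<open>\<Phi> t 0\<close>, so the values at \<open>- R\<close> and \<open>R\<close> enclose
      \<open>y\<close>. The summand 1 keeps \<open>R\<close> positive.\<close>
    define R where "R = \<bar>y - \<Phi> t 0\<bar> / c + 1"
    have "0 \<le> \<bar>y - \<Phi> t 0\<bar> / c" using c(1) by simp
    hence R: "0 < R" unfolding R_def by linarith
    have "c * R = \<bar>y - \<Phi> t 0\<bar> + c" using c(1) by (simp add: R_def field_simps)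
    moreover have "c * (R - 0) \<le> \<Phi> t R - \<Phi> t 0" "c * (0 - - R) \<le> \<Phi> t 0 - \<Phi> t (- R)"
      using c(3)[OF T(3), of 0 R] c(3)[OF T(3), of "- R" 0] R by auto
    ultimately have "\<Phi> t (- R) \<le> y" "y \<le> \<Phi> t R" using c(1) by auto
    moreover have "- R \<le> R" "continuous_on {- R..R} (\<Phi> t)" using R continuous_on_subset[OF cont] by auto
    ultimately obtain p where "\<Phi> t p = y" using IVT'[of "\<Phi> t" "- R" y R] by metis
    thus ?thesis by blast
  qed
  thus ?thesis using strict_mono_imp_inj_on[OF mono] by (auto simp: bij_def)
qed

section \<open>The two-parameter flow\<close>

lemma evolution_conv: "evolution \<alpha> f J s t x = \<Phi> t (inv (\<Phi> s) x)"
  by (simp add: evolution_def)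

lemma bij_evolution: "s \<in> J \<Longrightarrow> t \<in> J \<Longrightarrow> bij (evolution \<alpha> f J s t)"
  unfolding evolution_def by (rule bij_comp[OF bij_imp_bij_inv[OF bij_evolution0] bij_evolution0])

lemma evolution_cocycle:
  assumes "s \<in> J"
  shows "evolution \<alpha> f J s t \<circ> evolution \<alpha> f J u s = evolution \<alpha> f J u t"
  using inv_f_f[OF bij_is_inj[OF bij_evolution0[OF assms]]] by (simp add: fun_eq_iff evolution_conv)

lemma evolution0_inv: "s \<in> J \<Longrightarrow> \<Phi> s (inv (\<Phi> s) x) = x"
  by (rule surj_f_inv_f[OF bij_is_surj[OF bij_evolution0]])

lemma evolution_self: "s \<in> J \<Longrightarrow> evolution \<alpha> f J s s = id"
  by (simp add: fun_eq_iff evolution_conv evolution0_inv)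

text \<open>The bi-Lipschitz bounds are uniform in time, so continuity of \<open>\<Phi> s p\<close> in \<open>s\<close> alone
  already forces the inverses \<open>inv (\<Phi> s)\<close> to depend continuously on \<open>s\<close>.\<close>

lemma continuous_evolution: "continuous_on (J \<times> J \<times> UNIV) (\<lambda>(s, t, x). evolution \<alpha> f J s t x)"
  unfolding continuous_on_sequentially
proof (intro allI ballI impI, elim conjE)
  fix X :: "nat \<Rightarrow> real \<times> real \<times> real" and z
  assume z: "z \<in> J \<times> J \<times> UNIV" and X: "\<forall>n. X n \<in> J \<times> J \<times> UNIV" and lim: "X \<longlonglongrightarrow> z"
  define S R Y where "S = (\<lambda>n. fst (X n))" and "R = (\<lambda>n. fst (snd (X n)))" and "Y = (\<lambda>n. snd (snd (X n)))"
  obtain s t x where z_eq: "z = (s, t, x)" by (cases z)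
  have st: "s \<in> J" "t \<in> J" using z by (auto simp: z_eq)
  have SR: "S n \<in> J" "R n \<in> J" for n using X[rule_format, of n] by (auto simp: S_def R_def mem_Times_iff)
  have lims: "S \<longlonglongrightarrow> s" "R \<longlonglongrightarrow> t" "Y \<longlonglongrightarrow> x"
    using tendsto_fst[OF lim] tendsto_fst[OF tendsto_snd[OF lim]] tendsto_snd[OF tendsto_snd[OF lim]]
    by (auto simp: S_def R_def Y_def z_eq)
  \<comment> \<open>Convergent sequences are bounded, so a single \<open>T\<close> covers all times
    involved and one pair of bi-Lipschitz constants serves every \<open>n\<close>.\<close>
  obtain B1 where B1: "\<And>n. \<bar>S n\<bar> \<le> B1"
    using convergent_imp_Bseq[OF convergentI[OF lims(1)]] by (auto simp: Bseq_def)
  obtain B2 where B2: "\<And>n. \<bar>R n\<bar> \<le> B2"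
    using convergent_imp_Bseq[OF convergentI[OF lims(2)]] by (auto simp: Bseq_def)
  obtain T where T: "T \<in> J" "0 < T" "\<And>t. t \<in> J \<Longrightarrow> t \<le> max B1 B2 \<Longrightarrow> t \<in> {0..T}"
    using horizon[of "max B1 B2"] by blast
  have "S n \<le> max B1 B2" "R n \<le> max B1 B2" for n using B1[of n] B2[of n] by auto
  hence SRT: "S n \<in> {0..T}" "R n \<in> {0..T}" for n using T(3) SR by blast+
  obtain c C where c: "0 < c" "0 < C"
    "\<And>t p q. t \<in> {0..T} \<Longrightarrow> c * \<bar>p - q\<bar> \<le> \<bar>\<Phi> t p - \<Phi> t q\<bar>"
    "\<And>t p q. t \<in> {0..T} \<Longrightarrow> \<bar>\<Phi> t p - \<Phi> t q\<bar> \<le> C * \<bar>p - q\<bar>"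
    using evolution0_abs_bilipschitz[OF T(1,2)] by blast
  define p P where "p = inv (\<Phi> s) x" and "P = (\<lambda>n. inv (\<Phi> (S n)) (Y n))"
  have time: "(\<lambda>n. \<Phi> (r n) p) \<longlonglongrightarrow> \<Phi> q p" if "r \<longlonglongrightarrow> q" "\<And>n. r n \<in> J" "q \<in> J" for r q
    using evolution0_continuous_time[of p] that unfolding continuous_on_sequentially comp_def by blast
  \<comment> \<open>The lower bound transfers the question to the images, where
    \<open>\<Phi> (S n) (P n) = Y n\<close> and only continuity in time at the fixed point
    \<open>p\<close> is left.\<close>
  have "(\<lambda>n. P n - p) \<longlonglongrightarrow> 0"
  proof (rule Lim_null_comparison)
    show "\<forall>\<^sub>F n in sequentially. norm (P n - p) \<le> \<bar>Y n - \<Phi> (S n) p\<bar> / c"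
    proof (rule always_eventually, rule allI)
      fix n
      have "c * \<bar>P n - p\<bar> \<le> \<bar>\<Phi> (S n) (P n) - \<Phi> (S n) p\<bar>" using c(3) SRT by blast
      also have "\<Phi> (S n) (P n) = Y n" unfolding P_def using SR(1) by (rule evolution0_inv)
      finally show "norm (P n - p) \<le> \<bar>Y n - \<Phi> (S n) p\<bar> / c" using c(1) by (simp add: field_simps)
    qed
    have "(\<lambda>n. \<bar>Y n - \<Phi> (S n) p\<bar> / c) \<longlonglongrightarrow> \<bar>x - \<Phi> s p\<bar> / c"
      using c(1) st SR lims by (intro tendsto_intros time) auto
    thus "(\<lambda>n. \<bar>Y n - \<Phi> (S n) p\<bar> / c) \<longlonglongrightarrow> 0" using evolution0_inv[OF st(1)] by (simp add: p_def)
  qed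
  hence P: "(\<lambda>n. \<bar>P n - p\<bar>) \<longlonglongrightarrow> 0" by (rule tendsto_rabs_zero)
  \<comment> \<open>The upper bound replaces the moving argument \<open>P n\<close> by
    \<open>p\<close>; continuity in time then gives the limit.\<close>
  have "(\<lambda>n. \<Phi> (R n) (P n) - \<Phi> (R n) p) \<longlonglongrightarrow> 0"
  proof (rule Lim_null_comparison)
    show "\<forall>\<^sub>F n in sequentially. norm (\<Phi> (R n) (P n) - \<Phi> (R n) p) \<le> C * \<bar>P n - p\<bar>"
      using c(4) SRT by (intro always_eventually) auto
    show "(\<lambda>n. C * \<bar>P n - p\<bar>) \<longlonglongrightarrow> 0" using tendsto_mult_left[OF P, of C] by simp
  qed
  from tendsto_add[OF this time[OF lims(2) SR(2) st(2)]]
  have "(\<lambda>n. \<Phi> (R n) (P n)) \<longlonglongrightarrow> \<Phi> t p" by simp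
  moreover have "(\<lambda>(s, t, x). evolution \<alpha> f J s t x) \<circ> X = (\<lambda>n. \<Phi> (R n) (P n))"
    by (auto simp: fun_eq_iff S_def R_def Y_def P_def split_beta evolution_conv)
  ultimately show "((\<lambda>(s, t, x). evolution \<alpha> f J s t x) \<circ> X) \<longlonglongrightarrow> (case z of (s, t, x) \<Rightarrow> evolution \<alpha> f J s t x)"
    by (simp add: z_eq p_def evolution_conv)
qed

text \<open>By the cocycle law the inverse of the map from \<open>s\<close> to \<open>t\<close> is
  the map from \<open>t\<close> to \<open>s\<close>, so its continuity is another instance of joint
  continuity.\<close>

lemma two_param_flow_evolution: "two_param_flow J (evolution \<alpha> f J)"
  unfolding two_param_flow_def
proof (intro conjI ballI)
  have cont: "continuous_on UNIV (evolution \<alpha> f J s t)" if "s \<in> J" "t \<in> J" for s t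
  proof -
    have "continuous_on UNIV (\<lambda>x. (\<lambda>(s, t, x). evolution \<alpha> f J s t x) (s, t, x))"
      using that by (intro continuous_on_compose2[OF continuous_evolution] continuous_intros) auto
    thus ?thesis by simp
  qed
  fix s t assume st: "s \<in> J" "t \<in> J"
  have "evolution \<alpha> f J t s (evolution \<alpha> f J s t x) = x" "evolution \<alpha> f J s t (evolution \<alpha> f J t s x) = x" for x
    using evolution_cocycle[OF st(2), of s s] evolution_cocycle[OF st(1), of t t] evolution_self st
    by (auto simp: fun_eq_iff)
  hence "homeomorphism UNIV UNIV (evolution \<alpha> f J s t) (evolution \<alpha> f J t s)"
    using cont st by (intro homeomorphismI) auto
  thus "\<exists>g. homeomorphism UNIV UNIV (evolution \<alpha> f J s t) g" by blast
qed (use continuous_evolution evolution_cocycle in auto)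

text \<open>Multiples of the solution \<open>x\<close> with initial value 1 are again solutions, so
  \<open>\<Phi> r p = p * x r\<close>. Injectivity of \<open>\<Phi> s\<close> excludes
  \<open>x s = 0\<close>, and the evolution is multiplication by \<open>x t / x s\<close>.\<close>

lemma linear_evolution:
  assumes lin: "\<And>t x. t \<in> J \<Longrightarrow> f t x = a t * x" and st: "s \<in> J" "t \<in> J"
  shows "linear (evolution \<alpha> f J s t)"
proof -
  obtain x where x: "caputo_solution \<alpha> f J x" "x 0 = 1" using solution_exists .
  have "caputo_solution \<alpha> f J (\<lambda>t. p * x t)" for p
    unfolding caputo_solution_def
  proof (intro conjI ballI)
    have "continuous_on J x" using x(1) unfolding caputo_solution_def by blast
    thus "continuous_on J (\<lambda>t. p * x t)" by (intro continuous_intros)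
    fix t assume t: "t \<in> J"
    have e: "p * ((t - \<tau>) powr (\<alpha> - 1) * f \<tau> (x \<tau>)) = (t - \<tau>) powr (\<alpha> - 1) * f \<tau> (p * x \<tau>)"
      if "\<tau> \<in> {0..t}" for \<tau>
    proof -
      have "\<tau> \<in> J" using that Icc_subset_J[OF t] by blast
      thus ?thesis by (simp add: lin)
    qed
    have i: "(\<lambda>\<tau>. (t - \<tau>) powr (\<alpha> - 1) * f \<tau> (x \<tau>)) integrable_on {0..t}"
      and xt: "x t = x 0 + 1 / Gamma \<alpha> * integral {0..t} (\<lambda>\<tau>. (t - \<tau>) powr (\<alpha> - 1) * f \<tau> (x \<tau>))"
      using x(1) t unfolding caputo_solution_def by blast+
    have "(\<lambda>\<tau>. p * ((t - \<tau>) powr (\<alpha> - 1) * f \<tau> (x \<tau>))) integrable_on {0..t}"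
      using i by (rule integrable_on_mult_right)
    thus "(\<lambda>\<tau>. (t - \<tau>) powr (\<alpha> - 1) * f \<tau> (p * x \<tau>)) integrable_on {0..t}"
      by (rule integrable_eq) (use e in auto)
    have "integral {0..t} (\<lambda>\<tau>. (t - \<tau>) powr (\<alpha> - 1) * f \<tau> (p * x \<tau>))
        = integral {0..t} (\<lambda>\<tau>. p * ((t - \<tau>) powr (\<alpha> - 1) * f \<tau> (x \<tau>)))"
      by (rule integral_cong) (rule e[symmetric])
    also have "\<dots> = p * integral {0..t} (\<lambda>\<tau>. (t - \<tau>) powr (\<alpha> - 1) * f \<tau> (x \<tau>))"
      by (rule integral_mult_right)
    finally show "p * x t = p * x 0 + 1 / Gamma \<alpha> * integral {0..t} (\<lambda>\<tau>. (t - \<tau>) powr (\<alpha> - 1) * f \<tau> (p * x \<tau>))"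
      by (subst xt) (simp add: distrib_left)
  qed
  hence \<Phi>_eq: "\<Phi> r p = p * x r" if "r \<in> J" for r p
    using evolution0_solution[of "\<lambda>t. p * x t" r] that x(2) by simp
  have "x s \<noteq> 0"
  proof
    assume "x s = 0"
    hence "\<Phi> s 0 = \<Phi> s 1" using \<Phi>_eq[OF st(1)] by simp
    thus False using bij_is_inj[OF bij_evolution0[OF st(1)]] by (simp add: inj_eq)
  qed
  hence "inv (\<Phi> s) y = y / x s" for y
    using \<Phi>_eq[OF st(1)] bij_is_inj[OF bij_evolution0[OF st(1)]] by (intro inv_f_eq) auto
  hence "evolution \<alpha> f J s t = (\<lambda>y. (x t / x s) *\<^sub>R y)"
    using \<Phi>_eq[OF st(2)] by (auto simp: fun_eq_iff evolution_conv)
  thus ?thesis by (simp only: linear_scale_self)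
qed

end

theorem mainTheorem6:
  fixes \<alpha> :: real and J :: "real set" and f :: "real \<Rightarrow> real \<Rightarrow> real" and L :: "real \<Rightarrow> real"
  assumes alpha: "0 < \<alpha>" "\<alpha> < 1"
    and J: "(\<exists>T>0. J = {0..T}) \<or> J = {0..}"
    and f_cont: "continuous_on (J \<times> UNIV) (\<lambda>(t, x). f t x)"
    and L_cont: "continuous_on J L" and L_nonneg: "\<forall>t\<in>J. 0 \<le> L t"
    and lip: "\<forall>t\<in>J. \<forall>x y. \<bar>f t x - f t y\<bar> \<le> L t * \<bar>x - y\<bar>"
  shows "(\<forall>t\<in>J. bij (evolution0 \<alpha> f J t))
    \<and> (\<forall>s\<in>J. \<forall>t\<in>J. bij (evolution \<alpha> f J s t))
    \<and> (\<forall>u\<in>J. \<forall>s\<in>J. \<forall>t\<in>J. evolution \<alpha> f J s t \<circ> evolution \<alpha> f J u s = evolution \<alpha> f J u t)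
    \<and> two_param_flow J (evolution \<alpha> f J)
    \<and> ((\<exists>a. \<forall>t\<in>J. \<forall>x. f t x = a t * x) \<longrightarrow> (\<forall>s\<in>J. \<forall>t\<in>J. linear (evolution \<alpha> f J s t)))"
proof -
  interpret caputo_problem \<alpha> J f L
    using alpha J f_cont L_cont lip by unfold_locales auto
  show ?thesis
    using bij_evolution0 bij_evolution evolution_cocycle two_param_flow_evolution linear_evolution by blast
qed

end
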